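(* Let $C$ be a chord diagram whose interlace graph $G$ has all degrees even. (a) To a framing $\varphi\colon C\to\{\infty,0\}$, with corresponding filoop $\gamma$ in $F$, associate the two bicolourings $\chi\colon V_G\to\{\bullet,\circ\}$ obtained by choosing one of the two bicolourings of $F\setminus\gamma$ and colouring each intersection $x$ according to the region at $x$ in the direction of the sum of tangent vectors $\vec\gamma(x_\infty)+\vec\gamma(x_0)$; they differ by a global change of colour. (b) To a bicolouring, i.e. any map $\chi\colon V_G\to\{\bullet,\circ\}$, associate the two functions $\varphi\colon C\to\{\infty,0\}$ obtained by choosing the value on some letter and extending so that consecutive letters of the cyclic word $C$ have the same value if and only if they have different colours. These functions are framings of $C$, and they differ by a global frame inversion (exchange of $0$ and $\infty$). The constructions (a) and (b) are inverse to each other and yield a one-to-one correspondence between bicolourings $\chi\colon V_G\to\{\bullet,\circ\}$ up to global change of colour and framings $\varphi\colon C\to\{\infty,0\}$ up to global inversion.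
   Context: A chord diagram is a finite cyclic word $C$ in which every letter appears exactly twice, up to relabelling; its letters are called chords. A framing of $C$ is a function $\varphi\colon C\to\{0,\infty\}$ (defined on the set of occurrences) giving different values to the two occurrences of each letter; the occurrences of $x$ are then denoted $x_0,x_\infty$. The interlace graph $G$ has vertex set $V_G$ the set of chords and edges the pairs of chords whose occurrences alternate along the cyclic word. A map $\chi$ on $V_G$ is regarded as a function of the letters along the cyclic word. A filoop is a generic immersion $\gamma\colon\mathbb{S}^1\to F$ (all multiple points transverse double points) in a smooth closed connected oriented surface with $F\setminus\gamma$ a disjoint union of discs, up to orientation preserving diffeomorphisms of source and target. Each double point $x$ has preimages $x_\infty,x_0$ ordered so that the tangent vectors $(\vec\gamma(x_\infty),\vec\gamma(x_0))$ form a positive basis of $T_xF$; this gives a framed chord diagram, and every framed chord diagram arises from a unique filoop: take for each chord $x$ an oriented disc with four disjoint boundary intervals labelled $x_\infty^+,x_0^+,x_\infty^-,x_0^-$ in this cyclic order; for consecutive occurrences $u,v$ in $C$ join $u^+$ to $v^-$ by an orientation-compatible band; glue discs to all boundary components to obtain $F$. A bicolouring of $F\setminus\gamma$ is a map $F\setminus\gamma\to\{\bullet,\circ\}$, constant on components, changing colour when crossing $\gamma$ at smooth points; when all degrees of $G$ are even there are exactly two of them, exchanged by global change of colour. *)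

theory Defs
  imports "HOL-Analysis.Analysis"
begin

section \<open>Chord diagrams, interlace graphs, framings and vertex colourings\<close>

text \<open>
  A cyclic word is given by a list \<open>w\<close> representing it; the occurrences of its letters are the
  positions \<open>i < length w\<close>, and the occurrence following \<open>i\<close> is \<open>next_occ w i\<close>.
  Functions on occurrences or on chords are extensional, so that they are determined by their
  values on occurrences, respectively on chords.
\<close>

definition chord_diagram :: "'a list \<Rightarrow> bool" where
  "chord_diagram w \<longleftrightarrow> (\<forall>x\<in>set w. count_list w x = 2)"

definition next_occ :: "'a list \<Rightarrow> nat \<Rightarrow> nat" where
  "next_occ w i = Suc i mod length w"

definition interlaced :: "'a list \<Rightarrow> 'a \<Rightarrow> 'a \<Rightarrow> bool" where
  "interlaced w x y \<longleftrightarrow> x \<noteq> y \<and> filter (\<lambda>z. z \<in> {x, y}) w \<in> {[x, y, x, y], [y, x, y, x]}"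

definition interlace_degree :: "'a list \<Rightarrow> 'a \<Rightarrow> nat" where
  "interlace_degree w x = card {y \<in> set w. interlaced w x y}"

datatype frame = Frame_0 | Frame_inf

datatype colour = Black | White

fun opp_frame :: "frame \<Rightarrow> frame" where
  "opp_frame Frame_0 = Frame_inf"
| "opp_frame Frame_inf = Frame_0"

fun opp_colour :: "colour \<Rightarrow> colour" where
  "opp_colour Black = White"
| "opp_colour White = Black"

definition framings :: "'a list \<Rightarrow> (nat \<Rightarrow> frame) set" where
  "framings w = {\<phi> \<in> {..<length w} \<rightarrow>\<^sub>E UNIV.
     \<forall>i<length w. \<forall>j<length w. i \<noteq> j \<and> w ! i = w ! j \<longrightarrow> \<phi> i \<noteq> \<phi> j}"

definition colourings :: "'a list \<Rightarrow> ('a \<Rightarrow> colour) set" where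
  "colourings w = set w \<rightarrow>\<^sub>E UNIV"

definition invert_frames :: "'a list \<Rightarrow> (nat \<Rightarrow> frame) \<Rightarrow> nat \<Rightarrow> frame" where
  "invert_frames w \<phi> = (\<lambda>i\<in>{..<length w}. opp_frame (\<phi> i))"

definition swap_colours :: "'b set \<Rightarrow> ('b \<Rightarrow> colour) \<Rightarrow> 'b \<Rightarrow> colour" where
  "swap_colours A \<kappa> = (\<lambda>x\<in>A. opp_colour (\<kappa> x))"

definition framing_classes :: "'a list \<Rightarrow> (nat \<Rightarrow> frame) set set" where
  "framing_classes w = framings w //
     {(\<phi>, \<psi>). \<phi> \<in> framings w \<and> \<psi> \<in> framings w \<and> (\<psi> = \<phi> \<or> \<psi> = invert_frames w \<phi>)}"

definition colouring_classes :: "'a list \<Rightarrow> ('a \<Rightarrow> colour) set set" where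
  "colouring_classes w = colourings w //
     {(\<kappa>, \<eta>). \<kappa> \<in> colourings w \<and> \<eta> \<in> colourings w \<and> (\<eta> = \<kappa> \<or> \<eta> = swap_colours (set w) \<kappa>)}"


section \<open>The filoop of a framed chord diagram\<close>

definition quotient_topology :: "'b topology \<Rightarrow> ('b \<Rightarrow> 'c) \<Rightarrow> 'c topology" where
  "quotient_topology X f =
     topology (\<lambda>U. U \<subseteq> f ` topspace X \<and> openin X {x \<in> topspace X. f x \<in> U})"

lemma openin_quotient_topology:
  "openin (quotient_topology X f) U \<longleftrightarrow>
     U \<subseteq> f ` topspace X \<and> openin X {x \<in> topspace X. f x \<in> U}"
proof -
  have 1: "{x \<in> topspace X. f x \<in> S \<inter> T} =
      {x \<in> topspace X. f x \<in> S} \<inter> {x \<in> topspace X. f x \<in> T}" for S T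
    by auto
  have 2: "{x \<in> topspace X. f x \<in> \<Union>\<K>} = (\<Union>K\<in>\<K>. {x \<in> topspace X. f x \<in> K})" for \<K>
    by auto
  have "istopology (\<lambda>U. U \<subseteq> f ` topspace X \<and> openin X {x \<in> topspace X. f x \<in> U})"
    unfolding istopology_def 1 2 by blast
  then show ?thesis
    by (simp add: quotient_topology_def)
qed

lemma topspace_quotient_topology [simp]:
  "topspace (quotient_topology X f) = f ` topspace X"
proof -
  have "openin (quotient_topology X f) (f ` topspace X)"
    by (auto simp: openin_quotient_topology cong: conj_cong)
  then show ?thesis
    by (auto simp: topspace_def openin_quotient_topology)
qed

lemma quotient_map_quotient_topology:
  "quotient_map X (quotient_topology X f) f"
  by (auto simp: quotient_map_def openin_quotient_topology)

text \<open>
  The ribbon surface is assembled from one disc for each chord (the closed unit disc, with its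
  standard orientation) and one band for each occurrence \<open>i\<close>, running from \<open>i\<close> to the next
  occurrence. A band is the rectangle with real part in \<open>[0, 1]\<close> and imaginary part in
  \<open>[-1, 1]\<close>, and its core is the real segment.
  For the empty diagram there are no pieces, and the surface is empty.
\<close>

datatype 'a piece = Disc 'a | Band nat

definition band_rect :: "complex set" where
  "band_rect = {z. 0 \<le> Re z \<and> Re z \<le> 1 \<and> \<bar>Im z\<bar> \<le> 1}"

definition piece_set :: "'a piece \<Rightarrow> complex set" where
  "piece_set p = (case p of
     Disc x \<Rightarrow> cball 0 1
   | Band i \<Rightarrow> band_rect)"

definition pieces :: "'a list \<Rightarrow> ('a piece \<times> complex) topology" where
  "pieces w = sum_topology (\<lambda>p. top_of_set (piece_set p)) (Disc ` set w \<union> Band ` {..<length w})"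

text \<open>
  The direction in which the loop runs through the disc at occurrence \<open>i\<close>. For every chord
  \<open>x\<close> the directions at \<open>x_\<infinity>\<close> and \<open>x_0\<close> are \<open>1\<close> and \<open>\<i>\<close>, a positive basis.
\<close>

definition tangent :: "(nat \<Rightarrow> frame) \<Rightarrow> nat \<Rightarrow> complex" where
  "tangent \<phi> i = (if \<phi> i = Frame_inf then 1 else \<i>)"

text \<open>
  The intervals \<open>u\<^sup>+\<close> and \<open>u\<^sup>-\<close> of an occurrence \<open>u\<close> with direction \<open>d\<close> are the arcs of the unit
  circle of half-width \<open>pi / 8\<close> about \<open>d\<close> and \<open>- d\<close>; counterclockwise they are met in the order
  \<open>x_\<infinity>\<^sup>+, x_0\<^sup>+, x_\<infinity>\<^sup>-, x_0\<^sup>-\<close>. The left end of a band is glued to \<open>u\<^sup>+\<close> and its right end to \<open>v\<^sup>-\<close>,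
  where \<open>v\<close> is the next occurrence, in such a way that the left hand side of the core (positive
  imaginary part in the band) matches the left hand side of the oriented diameters.
  Points of the ribbon surface are represented by points of the pieces, a glued point being
  represented by its point in the disc.
\<close>

definition attach :: "'a list \<Rightarrow> (nat \<Rightarrow> frame) \<Rightarrow> 'a piece \<times> complex \<Rightarrow> 'a piece \<times> complex" where
  "attach w \<phi> q = (case q of
     (Disc x, z) \<Rightarrow> (Disc x, z)
   | (Band i, z) \<Rightarrow>
       if Re z = 0 then (Disc (w ! i), tangent \<phi> i * cis (Im z * pi / 8))
       else if Re z = 1 then
         (Disc (w ! next_occ w i), - tangent \<phi> (next_occ w i) * cis (- (Im z * pi / 8)))
       else (Band i, z))"

definition ribbon :: "'a list \<Rightarrow> (nat \<Rightarrow> frame) \<Rightarrow> ('a piece \<times> complex) topology" where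
  "ribbon w \<phi> = quotient_topology (pieces w) (attach w \<phi>)"

definition free_arcs :: "complex set" where
  "free_arcs = {z. cmod z = 1 \<and> (\<forall>k::nat. \<forall>t\<in>{-1<..<1}. z \<noteq> \<i> ^ k * cis (t * pi / 8))}"

definition ribbon_boundary :: "'a list \<Rightarrow> (nat \<Rightarrow> frame) \<Rightarrow> ('a piece \<times> complex) set" where
  "ribbon_boundary w \<phi> = attach w \<phi> `
     ({(Disc x, z) | x z. x \<in> set w \<and> z \<in> free_arcs} \<union>
      {(Band i, z) | i z. i < length w \<and> z \<in> band_rect \<and> \<bar>Im z\<bar> = 1})"

text \<open>
  Gluing a disc to a boundary circle \<open>K\<close> means adding the cone over \<open>K\<close>: the cylinder
  \<open>K \<times> [0, 1]\<close>, with \<open>K \<times> {0}\<close> identified with \<open>K\<close>, and with \<open>K \<times> {1}\<close> collapsed to a point.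
\<close>

definition collared_ribbon ::
  "'a list \<Rightarrow> (nat \<Rightarrow> frame) \<Rightarrow> (('a piece \<times> complex) \<times> real) topology" where
  "collared_ribbon w \<phi> = subtopology (prod_topology (ribbon w \<phi>) (top_of_set {0..1}))
     (topspace (ribbon w \<phi>) \<times> {0} \<union> ribbon_boundary w \<phi> \<times> {0..1})"

type_synonym 'a surface_point = "(('a piece \<times> complex) \<times> real) set"

definition collapse ::
  "'a list \<Rightarrow> (nat \<Rightarrow> frame) \<Rightarrow> ('a piece \<times> complex) \<times> real \<Rightarrow> 'a surface_point" where
  "collapse w \<phi> q = (case q of (p, t) \<Rightarrow>
     if t = 1
     then Collect (connected_component_of (subtopology (ribbon w \<phi>) (ribbon_boundary w \<phi>)) p) \<times> {1}
     else {(p, t)})"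

definition surface :: "'a list \<Rightarrow> (nat \<Rightarrow> frame) \<Rightarrow> 'a surface_point topology" where
  "surface w \<phi> = quotient_topology (collared_ribbon w \<phi>) (collapse w \<phi>)"

definition surface_pt ::
  "'a list \<Rightarrow> (nat \<Rightarrow> frame) \<Rightarrow> 'a piece \<Rightarrow> complex \<Rightarrow> 'a surface_point" where
  "surface_pt w \<phi> p z = collapse w \<phi> (attach w \<phi> (p, z), 0)"

text \<open>
  The loop is parametrised by times \<open>t \<ge> 0\<close> modulo \<open>n = length w\<close>. On \<open>[i, i + 1]\<close> it first runs
  through the diameter of occurrence \<open>i\<close> (passing the centre at time \<open>i + 1/4\<close>) and then along
  the core of the band \<open>i\<close>.
\<close>

definition filoop :: "'a list \<Rightarrow> (nat \<Rightarrow> frame) \<Rightarrow> real \<Rightarrow> 'a surface_point" where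
  "filoop w \<phi> t = (let i = nat \<lfloor>t\<rfloor> mod length w; s = frac t in
     if s < 1/2 then surface_pt w \<phi> (Disc (w ! i)) (of_real (4 * s - 1) * tangent \<phi> i)
     else surface_pt w \<phi> (Band i) (of_real (2 * s - 1)))"

definition complement :: "'a list \<Rightarrow> (nat \<Rightarrow> frame) \<Rightarrow> 'a surface_point set" where
  "complement w \<phi> = topspace (surface w \<phi>) - filoop w \<phi> ` {0..<real (length w)}"


section \<open>Bicolourings of the complement and the two constructions\<close>

text \<open>
  The smooth points are those of the band cores and those of the diameters other than the
  centres. The last two conditions compare the points at small distance \<open>h\<close> to the left and to the
  right of the loop; the end points of the diameters are covered as end points of band cores.
\<close>

definition region_bicolourings ::
  "'a list \<Rightarrow> (nat \<Rightarrow> frame) \<Rightarrow> ('a surface_point \<Rightarrow> colour) set" where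
  "region_bicolourings w \<phi> = {b \<in> complement w \<phi> \<rightarrow>\<^sub>E UNIV.
     (\<forall>K \<in> connected_components_of (subtopology (surface w \<phi>) (complement w \<phi>)).
        \<forall>p\<in>K. \<forall>q\<in>K. b p = b q) \<and>
     (\<forall>i<length w. \<forall>s\<in>{0..1}. \<forall>\<^sub>F h in at_right 0.
        b (surface_pt w \<phi> (Band i) (Complex s h)) \<noteq>
        b (surface_pt w \<phi> (Band i) (Complex s (- h)))) \<and>
     (\<forall>i<length w. \<forall>r\<in>{-1<..<1} - {0}. \<forall>\<^sub>F h in at_right 0.
        b (surface_pt w \<phi> (Disc (w ! i)) (tangent \<phi> i * Complex r h)) \<noteq>
        b (surface_pt w \<phi> (Disc (w ! i)) (tangent \<phi> i * Complex r (- h))))}"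

text \<open>The sum below is the sum of the two tangent vectors at the double point \<open>x\<close>.\<close>

definition induced_colouring ::
  "'a list \<Rightarrow> (nat \<Rightarrow> frame) \<Rightarrow> ('a surface_point \<Rightarrow> colour) \<Rightarrow> 'a \<Rightarrow> colour" where
  "induced_colouring w \<phi> b = (\<lambda>x\<in>set w. THE c. \<forall>\<^sub>F r in at_right 0.
     b (surface_pt w \<phi> (Disc x)
          (of_real r * (\<Sum>i | i < length w \<and> w ! i = x. tangent \<phi> i))) = c)"

definition framing_to_colourings :: "'a list \<Rightarrow> (nat \<Rightarrow> frame) \<Rightarrow> ('a \<Rightarrow> colour) set" where
  "framing_to_colourings w \<phi> = induced_colouring w \<phi> ` region_bicolourings w \<phi>"

definition colouring_to_framings :: "'a list \<Rightarrow> ('a \<Rightarrow> colour) \<Rightarrow> (nat \<Rightarrow> frame) set" where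
  "colouring_to_framings w \<kappa> = {\<phi> \<in> {..<length w} \<rightarrow>\<^sub>E UNIV.
     \<forall>i<length w. \<phi> i = \<phi> (next_occ w i) \<longleftrightarrow> \<kappa> (w ! i) \<noteq> \<kappa> (w ! next_occ w i)}"

end

theory Submission
  imports Defs
begin

text \<open>
  Both sides of the correspondence are governed by one relation: a framing and a colouring of the
  chords are compatible if consecutive occurrences have equal frames exactly when their colours
  differ.

  Adding up this relation modulo 2 along the word shows that it holds iff the sum of the frame of
  occurrence \<open>i\<close>, the colour of its chord and \<open>i\<close> is constant modulo 2; this closes up around the
  circle because the length is even. Since the degree of a chord in the interlace graph has the
  parity of the number of letters between its two occurrences, these occurrences sit at positions
  of opposite parity. Hence the equation can be solved for the colour given a framing, and its
  solution for the frame given a colouring is a framing.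

  On the surface, a bicolouring takes one value on each open quadrant of a disc and on each open
  half of a band, and it alternates around each double point. It is therefore determined by the
  colours of the quadrants in the directions of the sums of tangent vectors, and matching the
  quadrants at the two ends of a band is precisely compatibility. Conversely, compatible colours
  define a locally constant function on the ribbon surface without the loop, which is constant on
  each boundary circle and so extends over the cones.
\<close>

section \<open>Parities along a chord diagram\<close>

lemma filter_eq_replicate_count_list: "filter (\<lambda>z. z = y) xs = replicate (count_list xs y) y"
  by (induction xs) auto

text \<open>A chord \<open>y\<close> other than \<open>x\<close> crosses \<open>x\<close> iff
  exactly one of its two occurrences lies in \<open>B\<close>. Chords with none or both of them
  there contribute an even number to \<open>length B\<close>, so that length has the parity of the
  degree.\<close>

lemma even_interlace_degree_iff:
  assumes "chord_diagram (A @ x # B @ x # D)"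
  shows "even (interlace_degree (A @ x # B @ x # D) x) \<longleftrightarrow> even (length B)"
proof -
  let ?w = "A @ x # B @ x # D"
  have two: "count_list A y + count_list B y + count_list D y = 2" if "y \<in> set ?w" "y \<noteq> x" for y
    using that assms unfolding chord_diagram_def by fastforce
  have "count_list A x + count_list B x + count_list D x = 0"
    using assms unfolding chord_diagram_def by fastforce
  then have x: "x \<notin> set A" "x \<notin> set B" "x \<notin> set D"
    by (simp_all add: count_list_0_iff)
  have rep: "filter (\<lambda>z. z \<in> {x, y}) E = replicate (count_list E y) y" if "x \<notin> set E" for E y
  proof -
    have "filter (\<lambda>z. z \<in> {x, y}) E = filter (\<lambda>z. z = y) E"
      using that by (intro filter_cong) auto
    then show ?thesis
      by (simp add: filter_eq_replicate_count_list)
  qed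
  have inter: "interlaced ?w x y \<longleftrightarrow> count_list B y = 1" if "y \<in> set ?w" "y \<noteq> x" for y
  proof -
    have f: "filter (\<lambda>z. z \<in> {x, y}) ?w = replicate (count_list A y) y @ x #
        replicate (count_list B y) y @ x # replicate (count_list D y) y"
      using rep[OF x(1), of y] rep[OF x(2), of y] rep[OF x(3), of y] by simp
    \<comment> \<open>As the counts add up to 2, the restricted word is one of finitely many
      explicit lists; it alternates only if \<open>y\<close> occurs once between the two
      \<open>x\<close>.\<close>
    have ab: "count_list B y = 0 \<or> count_list B y = 1 \<and> count_list A y = 0 \<and> count_list D y = 1
        \<or> count_list B y = 1 \<and> count_list A y = 1 \<and> count_list D y = 0
        \<or> count_list B y = 2 \<and> count_list A y = 0 \<and> count_list D y = 0"
      using two[OF that] by linarith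
    show ?thesis
    proof (cases "count_list B y = 0")
      case True
      have "count_list A y = 0 \<or> count_list A y = 1 \<or> count_list A y = 2"
        using two[OF that] by linarith
      with True that show ?thesis
        unfolding interlaced_def f by (auto simp: numeral_2_eq_2)
    next
      case False
      with ab that show ?thesis
        unfolding interlaced_def f by (auto simp: numeral_2_eq_2)
    qed
  qed
  have odd1: "odd (count_list B y) \<longleftrightarrow> count_list B y = 1" if "y \<in> set B" for y
  proof -
    have "y \<noteq> x" using that x by auto
    then have "count_list B y \<le> 2" using two[of y] that by simp
    then have "count_list B y = 0 \<or> count_list B y = 1 \<or> count_list B y = 2" by linarith
    then show ?thesis by auto
  qed
  \<comment> \<open>\<open>even_sum_iff\<close> compares the parity of a sum with the number of its
    odd terms, so the degree is put in the form of such a number.\<close>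
  have "{y \<in> set ?w. interlaced ?w x y} = {y \<in> set B. odd (count_list B y)}"
  proof (intro set_eqI iffI; clarify)
    fix y assume y: "y \<in> set ?w" "interlaced ?w x y"
    then have "y \<noteq> x" unfolding interlaced_def by blast
    with y inter have "count_list B y = 1" by blast
    then show "y \<in> set B \<and> odd (count_list B y)"
      by (metis count_list_0_iff odd_one zero_neq_one)
  next
    fix y assume y: "y \<in> set B" "odd (count_list B y)"
    with x have "y \<noteq> x" by auto
    with y inter[of y] odd1[of y] show "y \<in> set ?w \<and> interlaced ?w x y" by simp
  qed
  then have "even (interlace_degree ?w x) \<longleftrightarrow> even (\<Sum>y\<in>set B. count_list B y)"
    by (simp add: interlace_degree_def even_sum_iff)
  then show ?thesis
    by (simp add: sum_count_set)
qed

text \<open>Exactly \<open>j - i - 1\<close> letters lie between the two occurrences, an even number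
  by the previous lemma. The even degrees enter all later arguments through this opposite parity of
  positions.\<close>

lemma odd_gap:
  assumes "chord_diagram w" "\<forall>x\<in>set w. even (interlace_degree w x)"
    and "i < j" "j < length w" "w ! i = w ! j"
  shows "odd (j - i)"
proof -
  define B where "B = take (j - Suc i) (drop (Suc i) w)"
  have "drop (Suc i) w = B @ drop (j - Suc i) (drop (Suc i) w)"
    unfolding B_def by (rule append_take_drop_id[symmetric])
  also have "drop (j - Suc i) (drop (Suc i) w) = w ! j # drop (Suc j) w"
    using assms by (simp add: Cons_nth_drop_Suc)
  finally have w: "w = take i w @ w ! i # B @ w ! i # drop (Suc j) w"
    using assms id_take_nth_drop[of i w] by simp
  have "even (interlace_degree w (w ! i))"
    using assms by simp
  then have "even (length B)"
    using even_interlace_degree_iff[of "take i w" "w ! i" B "drop (Suc j) w"] assms(1) w by simp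
  moreover have "length B = j - Suc i"
    using assms by (simp add: B_def)
  ultimately show ?thesis
    using assms(3) by (metis Suc_diff_Suc even_Suc)
qed

lemma even_length_chord_diagram:
  assumes "chord_diagram w"
  shows "even (length w)"
proof -
  have "length w = (\<Sum>x\<in>set w. count_list w x)"
    by (simp add: sum_count_set)
  also have "\<dots> = (\<Sum>x\<in>set w. 2)"
    using assms by (intro sum.cong) (auto simp: chord_diagram_def)
  finally show ?thesis
    by simp
qed

section \<open>Compatible framings and colourings as solutions of a parity equation\<close>

lemma opp_frame_eq_iff [simp]: "opp_frame a = opp_frame b \<longleftrightarrow> a = b"
  by (cases a; cases b) auto

lemma opp_colour_eq_iff [simp]: "opp_colour a = opp_colour b \<longleftrightarrow> a = b"
  by (cases a; cases b) auto

lemma opp_opp_frame [simp]: "opp_frame (opp_frame v) = v"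
  by (cases v) auto

lemma opp_opp_colour [simp]: "opp_colour (opp_colour c) = c"
  by (cases c) auto

lemma opp_colour_conv: "opp_colour a = b \<longleftrightarrow> a \<noteq> b"
  by (cases a; cases b) auto

lemma next_occ_less: "i < length w \<Longrightarrow> next_occ w i < length w"
  unfolding next_occ_def by (rule mod_less_divisor) auto

text \<open>Both constructions are fibres of this relation: construction (b) immediately,
  construction (a) by \<open>framing_to_colourings_eq\<close> after the analysis of the
  surface.\<close>

definition compatible :: "'a list \<Rightarrow> (nat \<Rightarrow> frame) \<Rightarrow> ('a \<Rightarrow> colour) \<Rightarrow> bool" where
  "compatible w \<phi> \<kappa> \<longleftrightarrow> (\<forall>i<length w. \<phi> i = \<phi> (next_occ w i) \<longleftrightarrow> \<kappa> (w ! i) \<noteq> \<kappa> (w ! next_occ w i))"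

text \<open>An iterated equality of three Booleans is their exclusive or, so this is the sum modulo
  2 of frame, colour and position.\<close>

definition parity :: "'a list \<Rightarrow> (nat \<Rightarrow> frame) \<Rightarrow> ('a \<Rightarrow> colour) \<Rightarrow> nat \<Rightarrow> bool" where
  "parity w \<phi> \<kappa> i \<longleftrightarrow> ((\<phi> i = Frame_inf) = (\<kappa> (w ! i) = Black)) = even i"

text \<open>Compatibility means that exactly one of frame and colour changes from an occurrence to
  the next. The parity of the position changes as well, so the sum of the three is
  preserved.\<close>

lemma compatible_iff_parity:
  assumes "even (length w)"
  shows "compatible w \<phi> \<kappa> \<longleftrightarrow> (\<exists>c. \<forall>i<length w. parity w \<phi> \<kappa> i = c)"
proof -
  have frame: "a = b \<longleftrightarrow> (a = Frame_inf \<longleftrightarrow> b = Frame_inf)" for a b by (cases a; cases b) auto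
  have col: "a = b \<longleftrightarrow> (a = Black \<longleftrightarrow> b = Black)" for a b by (cases a; cases b) auto
  have step: "(\<phi> i = \<phi> (next_occ w i) \<longleftrightarrow> \<kappa> (w ! i) \<noteq> \<kappa> (w ! next_occ w i))
      \<longleftrightarrow> parity w \<phi> \<kappa> i = parity w \<phi> \<kappa> (next_occ w i)" if "i < length w" for i
  proof -
    \<comment> \<open>The last position is odd and is followed by position 0, so the parity of the
      position flips there too; this is where the length must be even.\<close>
    have "even (next_occ w i) \<longleftrightarrow> odd i"
    proof (cases "Suc i = length w")
      case True
      with assms have "odd i"
        by (metis even_Suc)
      with True show ?thesis
        by (simp add: next_occ_def)
    qed (use that in \<open>simp add: next_occ_def\<close>)
    then show ?thesis
      using frame[of "\<phi> i" "\<phi> (next_occ w i)"] col[of "\<kappa> (w ! i)" "\<kappa> (w ! next_occ w i)"]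
      unfolding parity_def by argo
  qed
  have "parity w \<phi> \<kappa> i = parity w \<phi> \<kappa> 0" if "compatible w \<phi> \<kappa>" "i < length w" for i
    using that(2)
  proof (induction i)
    case (Suc i)
    then have "next_occ w i = Suc i" by (simp add: next_occ_def)
    with step[of i] Suc that(1) show ?case unfolding compatible_def
      by (metis Suc_lessD)
  qed simp
  moreover have "compatible w \<phi> \<kappa>" if "\<forall>i<length w. parity w \<phi> \<kappa> i = c" for c
    unfolding compatible_def
  proof (intro allI impI)
    fix i assume i: "i < length w"
    then have "next_occ w i < length w" by (rule next_occ_less)
    with that i show "\<phi> i = \<phi> (next_occ w i) \<longleftrightarrow> \<kappa> (w ! i) \<noteq> \<kappa> (w ! next_occ w i)"
      using step[OF i] by blast
  qed
  ultimately show ?thesis by blast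
qed

lemma colourings_nth_eqI:
  assumes "\<kappa> \<in> colourings w" "\<eta> \<in> colourings w" "\<And>i. i < length w \<Longrightarrow> \<kappa> (w ! i) = \<eta> (w ! i)"
  shows "\<kappa> = \<eta>"
  using assms unfolding colourings_def
  by (intro PiE_ext) (auto simp: in_set_conv_nth)

lemma parity_swap_colours:
  "i < length w \<Longrightarrow> parity w \<phi> (swap_colours (set w) \<kappa>) i \<longleftrightarrow> \<not> parity w \<phi> \<kappa> i"
  by (cases "\<kappa> (w ! i)") (auto simp: parity_def swap_colours_def)

lemma swap_colours_colourings: "swap_colours (set w) \<kappa> \<in> colourings w"
  by (simp add: swap_colours_def colourings_def)

lemma swap_swap_colours:
  assumes "\<kappa> \<in> colourings w"
  shows "swap_colours (set w) (swap_colours (set w) \<kappa>) = \<kappa>"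
proof (rule PiE_ext)
  show "swap_colours (set w) (swap_colours (set w) \<kappa>) \<in> set w \<rightarrow>\<^sub>E UNIV"
    by (simp add: swap_colours_def)
  show "\<kappa> \<in> set w \<rightarrow>\<^sub>E UNIV"
    using assms by (simp add: colourings_def)
qed (simp add: swap_colours_def)

lemma compatible_swap_colours:
  "compatible w \<phi> (swap_colours (set w) \<kappa>) \<longleftrightarrow> compatible w \<phi> \<kappa>"
  unfolding compatible_def by (intro iff_allI imp_cong refl) (simp add: swap_colours_def next_occ_less)

lemma invert_frames_framings: "\<phi> \<in> framings w \<Longrightarrow> invert_frames w \<phi> \<in> framings w"
  by (auto simp: framings_def invert_frames_def)

lemma invert_invert_frames:
  assumes "\<phi> \<in> framings w"
  shows "invert_frames w (invert_frames w \<phi>) = \<phi>"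
proof (rule PiE_ext)
  show "invert_frames w (invert_frames w \<phi>) \<in> {..<length w} \<rightarrow>\<^sub>E UNIV"
    by (simp add: invert_frames_def)
  show "\<phi> \<in> {..<length w} \<rightarrow>\<^sub>E UNIV"
    using assms by (simp add: framings_def)
qed (simp add: invert_frames_def)

text \<open>The parity equation with a given constant determines the colour at each occurrence. The
  two occurrences of a chord differ both in frame and in the parity of the position, so they
  prescribe the same colour. The two constants give the two solutions.\<close>

lemma compatible_colourings:
  assumes "chord_diagram w" "\<forall>x\<in>set w. even (interlace_degree w x)" "\<phi> \<in> framings w"
  shows "\<exists>\<kappa>\<in>colourings w. {\<kappa> \<in> colourings w. compatible w \<phi> \<kappa>} = {\<kappa>, swap_colours (set w) \<kappa>}"
proof -
  note ev = even_length_chord_diagram[OF assms(1)]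
  \<comment> \<open>\<open>col i\<close> is the colour that makes the parity at \<open>i\<close>
    equal to \<open>True\<close>.\<close>
  define col where "col i = (if (\<phi> i = Frame_inf) = even i then Black else White)" for i
  have col: "col i = col j" if "i < length w" "j < length w" "w ! i = w ! j" "i < j" for i j
  proof -
    have "odd (j - i)" using odd_gap assms that by blast
    moreover have "\<phi> i \<noteq> \<phi> j" using assms(3) that by (auto simp: framings_def)
    ultimately show ?thesis using that(4) by (cases "\<phi> i"; cases "\<phi> j") (auto simp: col_def)
  qed
  \<comment> \<open>By the fact \<open>col\<close>, the choice of the occurrence does not affect the
    value.\<close>
  define \<kappa> where "\<kappa> = (\<lambda>x\<in>set w. col (SOME i. i < length w \<and> w ! i = x))"
  have \<kappa>_col: "\<kappa> (w ! i) = col i" if "i < length w" for i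
  proof -
    define k where "k = (SOME k. k < length w \<and> w ! k = w ! i)"
    have "k < length w \<and> w ! k = w ! i" unfolding k_def by (rule someI) (use that in auto)
    moreover have "\<kappa> (w ! i) = col k" using that by (simp add: \<kappa>_def k_def)
    ultimately show ?thesis using col that by (metis linorder_neqE_nat)
  qed
  have \<kappa>: "\<kappa> \<in> colourings w" by (simp add: \<kappa>_def colourings_def)
  have par: "parity w \<phi> \<kappa> i" if "i < length w" for i
    using \<kappa>_col[OF that] by (auto simp: parity_def col_def split: if_splits)
  \<comment> \<open>The constant parity of a compatible \<eta> decides which of the two solutions it
    is.\<close>
  have "\<eta> = \<kappa> \<or> \<eta> = swap_colours (set w) \<kappa>" if \<eta>: "\<eta> \<in> colourings w" "compatible w \<phi> \<eta>" for \<eta>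
  proof -
    have *: "\<eta> = \<theta>" if "\<theta> \<in> colourings w" "\<And>i. i < length w \<Longrightarrow> parity w \<phi> \<eta> i = parity w \<phi> \<theta> i" for \<theta>
    proof (rule colourings_nth_eqI[OF \<eta>(1) that(1)])
      show "\<eta> (w ! i) = \<theta> (w ! i)" if "i < length w" for i
        using \<open>\<And>i. i < length w \<Longrightarrow> parity w \<phi> \<eta> i = parity w \<phi> \<theta> i\<close>[OF that]
        by (cases "\<eta> (w ! i)"; cases "\<theta> (w ! i)") (auto simp: parity_def)
    qed
    obtain c where "\<forall>i<length w. parity w \<phi> \<eta> i = c"
      using \<eta>(2) compatible_iff_parity[OF ev] by blast
    then show ?thesis
      using *[of \<kappa>] *[of "swap_colours (set w) \<kappa>"] \<kappa> par
      by (cases c) (auto simp: parity_swap_colours swap_colours_colourings)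
  qed
  moreover have "compatible w \<phi> \<kappa>"
    unfolding compatible_iff_parity[OF ev] by (rule exI[of _ True]) (simp add: par)
  moreover have "compatible w \<phi> (swap_colours (set w) \<kappa>)"
    unfolding compatible_iff_parity[OF ev] by (rule exI[of _ False]) (simp add: par parity_swap_colours)
  ultimately have "{\<eta> \<in> colourings w. compatible w \<phi> \<eta>} = {\<kappa>, swap_colours (set w) \<kappa>}"
    using \<kappa> swap_colours_colourings[of w \<kappa>] by blast
  with \<kappa> show ?thesis
    by blast
qed

section \<open>Solving for the framing when the colouring is given\<close>

lemma colouring_to_framings_eq:
  "colouring_to_framings w \<kappa> = {\<phi> \<in> {..<length w} \<rightarrow>\<^sub>E UNIV. compatible w \<phi> \<kappa>}"
  by (simp add: colouring_to_framings_def compatible_def)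

text \<open>The two occurrences of a chord share their colour and have positions of opposite parity;
  as the total is constant, their frames differ.\<close>

lemma compatible_framing:
  assumes "chord_diagram w" "\<forall>x\<in>set w. even (interlace_degree w x)"
    and "\<phi> \<in> colouring_to_framings w \<kappa>"
  shows "\<phi> \<in> framings w"
proof -
  obtain c where c: "\<And>i. i < length w \<Longrightarrow> parity w \<phi> \<kappa> i = c"
    using assms compatible_iff_parity[OF even_length_chord_diagram[OF assms(1)]]
    by (auto simp: colouring_to_framings_eq)
  have "\<phi> i \<noteq> \<phi> j" if "i < j" "j < length w" "w ! i = w ! j" for i j
  proof -
    have "odd (j - i)" using odd_gap assms that by blast
    then have "even i \<noteq> even j" using that(1) by simp
    with c[of i] c[of j] that show ?thesis
      by (auto simp: parity_def)
  qed
  then have "\<phi> i \<noteq> \<phi> j" if "i \<noteq> j" "i < length w" "j < length w" "w ! i = w ! j" for i j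
    using that by (metis linorder_neqE_nat)
  with assms(3) show ?thesis
    by (auto simp: framings_def colouring_to_framings_eq)
qed

text \<open>The parity equation with constant \<open>c\<close>, solved for the frame.\<close>

definition alternating_framing :: "'a list \<Rightarrow> ('a \<Rightarrow> colour) \<Rightarrow> bool \<Rightarrow> nat \<Rightarrow> frame" where
  "alternating_framing w \<kappa> c =
     (\<lambda>i\<in>{..<length w}. if ((\<kappa> (w ! i) = Black) = even i) = c then Frame_inf else Frame_0)"

text \<open>The constant \<open>c\<close> takes two values, each with exactly one solution. On the
  empty word the two solutions coincide.\<close>

lemma colouring_to_framings_alternating:
  assumes "chord_diagram w"
  shows "colouring_to_framings w \<kappa> = {alternating_framing w \<kappa> True, alternating_framing w \<kappa> False}"
proof -
  have par: "(\<forall>i<length w. parity w \<phi> \<kappa> i = c) \<longleftrightarrow> \<phi> = alternating_framing w \<kappa> c"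
    if "\<phi> \<in> {..<length w} \<rightarrow>\<^sub>E UNIV" for \<phi> c
  proof
    assume *: "\<forall>i<length w. parity w \<phi> \<kappa> i = c"
    show "\<phi> = alternating_framing w \<kappa> c"
    proof (rule PiE_ext[OF that])
      show "alternating_framing w \<kappa> c \<in> {..<length w} \<rightarrow>\<^sub>E UNIV"
        by (simp add: alternating_framing_def)
      fix i assume "i \<in> {..<length w}"
      with * show "\<phi> i = alternating_framing w \<kappa> c i"
        by (cases "\<phi> i") (auto simp: parity_def alternating_framing_def)
    qed
  qed (auto simp: parity_def alternating_framing_def split: if_splits)
  have "\<phi> \<in> colouring_to_framings w \<kappa> \<longleftrightarrow> (\<exists>c. \<phi> = alternating_framing w \<kappa> c)" for \<phi>
  proof
    assume "\<phi> \<in> colouring_to_framings w \<kappa>"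
    then have "\<phi> \<in> {..<length w} \<rightarrow>\<^sub>E UNIV" "compatible w \<phi> \<kappa>"
      unfolding colouring_to_framings_eq by blast+
    then show "\<exists>c. \<phi> = alternating_framing w \<kappa> c"
      using par[of \<phi>] compatible_iff_parity[OF even_length_chord_diagram[OF assms], of \<phi> \<kappa>] by metis
  next
    assume "\<exists>c. \<phi> = alternating_framing w \<kappa> c"
    then obtain c where c: "\<phi> = alternating_framing w \<kappa> c" ..
    then have "\<phi> \<in> {..<length w} \<rightarrow>\<^sub>E UNIV" by (simp add: alternating_framing_def)
    moreover from this c have "compatible w \<phi> \<kappa>"
      using par[of \<phi> c] compatible_iff_parity[OF even_length_chord_diagram[OF assms], of \<phi> \<kappa>] by metis
    ultimately show "\<phi> \<in> colouring_to_framings w \<kappa>"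
      unfolding colouring_to_framings_eq by blast
  qed
  then show ?thesis
    by (auto simp: ex_bool_eq)
qed

lemma invert_alternating_framing:
  "invert_frames w (alternating_framing w \<kappa> c) = alternating_framing w \<kappa> (\<not> c)"
  by (auto simp: invert_frames_def alternating_framing_def fun_eq_iff)

text \<open>The two solutions take opposite values at every occurrence, so each of the two frames is
  attained by exactly one of them.\<close>

lemma ex1_colouring_to_framings:
  assumes "chord_diagram w" "i < length w"
  shows "\<exists>!\<phi>. \<phi> \<in> colouring_to_framings w \<kappa> \<and> \<phi> i = v"
proof -
  have "alternating_framing w \<kappa> True i \<noteq> alternating_framing w \<kappa> False i"
    using assms(2) by (simp add: alternating_framing_def)
  then show ?thesis
    unfolding colouring_to_framings_alternating[OF assms(1)]
    using frame.exhaust[of v] frame.exhaust[of "alternating_framing w \<kappa> True i"]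
      frame.exhaust[of "alternating_framing w \<kappa> False i"]
    by (metis insert_iff singletonD)
qed

section \<open>Bicolourings of the filoop complement\<close>

text \<open>The zero set is the union of the two axes, which carry the diameters of the loop in a
  disc. The sign is positive on the quadrant containing \<open>1 + \<i>\<close>, the sum of the
  tangent vectors, and on the opposite one, and negative on the other two.\<close>

definition quad :: "complex \<Rightarrow> real" where
  "quad z = Re z * Im z"

definition off_loop :: "'a piece \<times> complex \<Rightarrow> bool" where
  "off_loop p = (case p of (Disc x, z) \<Rightarrow> quad z \<noteq> 0 | (Band i, z) \<Rightarrow> Im z \<noteq> 0)"

text \<open>The checkerboard colouring around a double point, normalised by the quadrant of the sum
  of the tangent vectors.\<close>

definition disc_colour :: "('a \<Rightarrow> colour) \<Rightarrow> 'a \<Rightarrow> complex \<Rightarrow> colour" where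
  "disc_colour \<kappa> x z = (if 0 < quad z then \<kappa> x else opp_colour (\<kappa> x))"

text \<open>The colour on the left of the loop where it leaves the disc at occurrence
  \<open>i\<close>: this is the first quadrant for the direction \<open>1\<close> and the second for
  \<open>\<i>\<close>.\<close>

definition left_colour :: "'a list \<Rightarrow> (nat \<Rightarrow> frame) \<Rightarrow> ('a \<Rightarrow> colour) \<Rightarrow> nat \<Rightarrow> colour" where
  "left_colour w \<phi> \<kappa> i = (if \<phi> i = Frame_inf then \<kappa> (w ! i) else opp_colour (\<kappa> (w ! i)))"

definition band_colour :: "'a list \<Rightarrow> (nat \<Rightarrow> frame) \<Rightarrow> ('a \<Rightarrow> colour) \<Rightarrow> nat \<Rightarrow> complex \<Rightarrow> colour" where
  "band_colour w \<phi> \<kappa> i z =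
     (if 0 < Im z then left_colour w \<phi> \<kappa> i else opp_colour (left_colour w \<phi> \<kappa> i))"

text \<open>The value at points on the loop is an arbitrary default.\<close>

definition ribbon_colour ::
  "'a list \<Rightarrow> (nat \<Rightarrow> frame) \<Rightarrow> ('a \<Rightarrow> colour) \<Rightarrow> 'a piece \<times> complex \<Rightarrow> colour" where
  "ribbon_colour w \<phi> \<kappa> p =
     (case p of (Disc x, z) \<Rightarrow> disc_colour \<kappa> x z | (Band i, z) \<Rightarrow> band_colour w \<phi> \<kappa> i z)"

lemma quad_minus [simp]: "quad (- z) = quad z"
  by (simp add: quad_def)

lemma quad_tangent: "quad (tangent \<phi> i * z) = (if \<phi> i = Frame_inf then quad z else - quad z)"
  by (simp add: quad_def tangent_def)

text \<open>The angle has absolute value at most \<open>pi / 8\<close>, so its cosine is positive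
  and the sign of \<open>quad\<close> is that of the sine, hence of \<open>t\<close>.\<close>

lemma quad_cis:
  assumes "\<bar>t\<bar> \<le> 1"
  shows "0 < quad (cis (t * pi / 8)) \<longleftrightarrow> 0 < t" and "quad (cis (t * pi / 8)) < 0 \<longleftrightarrow> t < 0"
    and "quad (cis (t * pi / 8)) = 0 \<longleftrightarrow> t = 0" and "quad (cis (- (t * pi / 8))) = - quad (cis (t * pi / 8))"
proof -
  define \<theta> where "\<theta> = t * pi / 8"
  have "\<bar>\<theta>\<bar> = \<bar>t\<bar> * pi / 8"
    by (simp add: \<theta>_def abs_mult)
  also have "\<dots> \<le> pi / 8"
    using assms by simp
  finally have \<theta>: "\<bar>\<theta>\<bar> \<le> pi / 8" .
  have "- (pi / 2) < \<theta>" "\<theta> < pi / 2"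
    using \<theta> pi_gt_zero by linarith+
  then have c: "0 < cos \<theta>" by (rule cos_gt_zero_pi)
  have "\<theta> < pi" "- \<theta> < pi"
    using \<theta> pi_gt_zero by linarith+
  then have "t > 0 \<Longrightarrow> sin \<theta> > 0"
    by (intro sin_gt_zero) (simp_all add: \<theta>_def)
  moreover have "t < 0 \<Longrightarrow> sin (- \<theta>) > 0"
    using \<open>- \<theta> < pi\<close> by (intro sin_gt_zero) (simp_all add: \<theta>_def mult_neg_pos)
  moreover have "t = 0 \<Longrightarrow> sin \<theta> = 0"
    by (simp add: \<theta>_def)
  ultimately have "(0 < sin \<theta>) = (0 < t)" "(sin \<theta> < 0) = (t < 0)" "(sin \<theta> = 0) = (t = 0)"
    by (cases t "0::real" rule: linorder_cases; force)+
  with c show "0 < quad (cis (t * pi / 8)) \<longleftrightarrow> 0 < t" "quad (cis (t * pi / 8)) < 0 \<longleftrightarrow> t < 0"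
    "quad (cis (t * pi / 8)) = 0 \<longleftrightarrow> t = 0"
    unfolding \<theta>_def[symmetric] by (simp_all add: quad_def zero_less_mult_iff mult_less_0_iff)
qed (simp add: quad_def)

lemma cmod_tangent [simp]: "cmod (tangent \<phi> i) = 1"
  by (simp add: tangent_def)

lemma attach_Disc [simp]: "attach w \<phi> (Disc x, z) = (Disc x, z)"
  by (simp add: attach_def)

lemma attach_Band_left:
  "Re z = 0 \<Longrightarrow> attach w \<phi> (Band i, z) = (Disc (w ! i), tangent \<phi> i * cis (Im z * pi / 8))"
  by (simp add: attach_def)

lemma attach_Band_right:
  "Re z = 1 \<Longrightarrow> attach w \<phi> (Band i, z) =
    (Disc (w ! next_occ w i), - (tangent \<phi> (next_occ w i) * cis (- (Im z * pi / 8))))"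
  by (simp add: attach_def)

lemma attach_Band_inside: "Re z \<noteq> 0 \<Longrightarrow> Re z \<noteq> 1 \<Longrightarrow> attach w \<phi> (Band i, z) = (Band i, z)"
  by (simp add: attach_def)

text \<open>The ends of a band are glued to arcs centred at end points of the diameters, and
  \<open>quad\<close> vanishes on such an arc only at its centre, the image of an end of the
  core.\<close>

lemma off_loop_attach_Band:
  assumes "z \<in> band_rect"
  shows "off_loop (attach w \<phi> (Band i, z)) \<longleftrightarrow> Im z \<noteq> 0"
  using assms quad_cis[of "Im z"]
  by (cases "Re z = 0"; cases "Re z = 1")
    (auto simp: off_loop_def attach_Band_left attach_Band_right attach_Band_inside quad_tangent
      band_rect_def)

text \<open>The loop enters the next disc at minus its direction. To its left is then the second
  quadrant for the direction \<open>1\<close> and the third for \<open>\<i>\<close>, which gives the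
  right hand side; compatibility makes both ends of the band yield the same left colour.\<close>

lemma compatible_left_colour:
  assumes "\<phi> i = \<phi> (next_occ w i) \<longleftrightarrow> \<kappa> (w ! i) \<noteq> \<kappa> (w ! next_occ w i)"
  shows "left_colour w \<phi> \<kappa> i = (if \<phi> (next_occ w i) = Frame_inf
    then opp_colour (\<kappa> (w ! next_occ w i)) else \<kappa> (w ! next_occ w i))"
  using assms unfolding left_colour_def
  by (cases "\<phi> i"; cases "\<phi> (next_occ w i)"; cases "\<kappa> (w ! i)"; cases "\<kappa> (w ! next_occ w i)") auto

text \<open>This converse recovers compatibility from a bicolouring of the surface.\<close>

lemma left_colour_compatible:
  assumes "left_colour w \<phi> \<kappa> i = (if \<phi> (next_occ w i) = Frame_inf
    then opp_colour (\<kappa> (w ! next_occ w i)) else \<kappa> (w ! next_occ w i))"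
  shows "\<phi> i = \<phi> (next_occ w i) \<longleftrightarrow> \<kappa> (w ! i) \<noteq> \<kappa> (w ! next_occ w i)"
  using assms unfolding left_colour_def
  by (cases "\<phi> i"; cases "\<phi> (next_occ w i)"; cases "\<kappa> (w ! i)"; cases "\<kappa> (w ! next_occ w i)") auto

lemma opp_colour_neq [simp]: "opp_colour c \<noteq> c" "c \<noteq> opp_colour c"
  by (cases c; simp)+

text \<open>The colours of discs and bands agree under the gluing: at the left end by the choice of
  \<open>left_colour\<close>, at the right end by compatibility.\<close>

lemma ribbon_colour_attach_Band:
  assumes "compatible w \<phi> \<kappa>" "i < length w" "z \<in> band_rect" "Im z \<noteq> 0"
  shows "ribbon_colour w \<phi> \<kappa> (attach w \<phi> (Band i, z)) = band_colour w \<phi> \<kappa> i z"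
proof -
  have im: "\<bar>Im z\<bar> \<le> 1" using assms(3) by (simp add: band_rect_def)
  note q = quad_cis[OF im]
  consider "Re z = 0" | "Re z = 1" | "Re z \<noteq> 0" "Re z \<noteq> 1" by blast
  then show ?thesis
  proof cases
    case 1
    then show ?thesis
      using q assms(4)
      by (auto simp: ribbon_colour_def attach_Band_left band_colour_def disc_colour_def quad_tangent left_colour_def)
  next
    case 2
    have "\<phi> i = \<phi> (next_occ w i) \<longleftrightarrow> \<kappa> (w ! i) \<noteq> \<kappa> (w ! next_occ w i)"
      using assms by (simp add: compatible_def)
    note left = compatible_left_colour[of \<phi> i w \<kappa>, OF this]
    show ?thesis
      using q assms(4) 2
      by (auto simp: ribbon_colour_def attach_Band_right band_colour_def disc_colour_def quad_tangent left)
  next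
    case 3
    then show ?thesis
      by (simp add: ribbon_colour_def attach_Band_inside)
  qed
qed

section \<open>Points of the ribbon, of its boundary and of the capped surface\<close>

lemma topspace_pieces:
  "topspace (pieces w) = Sigma (Disc ` set w \<union> Band ` {..<length w}) piece_set"
  by (auto simp: pieces_def)

lemma piece_set_simps [simp]: "piece_set (Disc x) = cball 0 1" "piece_set (Band i) = band_rect"
  by (simp_all add: piece_set_def)

lemma topspace_ribbon: "topspace (ribbon w \<phi>) = attach w \<phi> ` topspace (pieces w)"
  by (simp add: ribbon_def)

lemma attach_in_ribbon:
  "p \<in> Disc ` set w \<union> Band ` {..<length w} \<Longrightarrow> z \<in> piece_set p \<Longrightarrow> attach w \<phi> (p, z) \<in> topspace (ribbon w \<phi>)"
  by (auto simp: topspace_ribbon topspace_pieces)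

lemma ribbon_cases:
  assumes "p \<in> topspace (ribbon w \<phi>)"
  obtains x z where "p = (Disc x, z)" "x \<in> set w" "cmod z \<le> 1"
  | i z where "p = (Band i, z)" "i < length w" "z \<in> band_rect" "Re z \<noteq> 0" "Re z \<noteq> 1"
proof -
  obtain q z where q: "q \<in> Disc ` set w \<union> Band ` {..<length w}" "z \<in> piece_set q"
    "p = attach w \<phi> (q, z)"
    using assms by (auto simp: topspace_ribbon topspace_pieces)
  show ?thesis
  proof (cases q)
    case (Disc x)
    then show ?thesis using q that(1) by auto
  next
    case (Band i)
    with q have i: "i < length w" "z \<in> band_rect" by auto
    have n: "next_occ w i < length w" using i by (simp add: next_occ_less)
    show ?thesis
      using that i n q(3)
      by (cases "Re z = 0"; cases "Re z = 1")
        (auto simp: Band attach_Band_left attach_Band_right attach_Band_inside norm_mult)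
  qed
qed

text \<open>On the unit circle \<open>quad\<close> vanishes only at the four powers of
  \<open>\<i>\<close>, and these are the centres of the four gluing arcs.\<close>

lemma free_arcs_quad:
  assumes "z \<in> free_arcs"
  shows "quad z \<noteq> 0"
proof
  assume 0: "quad z = 0"
  have z: "cmod z = 1" and "\<forall>k::nat. \<forall>t\<in>{-1<..<1}. z \<noteq> \<i> ^ k * cis (t * pi / 8)"
    using assms by (auto simp: free_arcs_def)
  from this(2) have *: "z \<noteq> \<i> ^ k * cis (0 * pi / 8)" for k
    by (metis atLeastLessThan_iff greaterThanLessThan_iff neg_less_0_iff_less zero_less_one)
  have "Re z = 0 \<and> \<bar>Im z\<bar> = 1 \<or> Im z = 0 \<and> \<bar>Re z\<bar> = 1"
    using 0 z by (auto simp: quad_def cmod_def power2_eq_1_iff)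
  then have "z = 1 \<or> z = \<i> \<or> z = -1 \<or> z = - \<i>"
    by (auto simp: complex_eq_iff abs_if split: if_splits)
  moreover have "\<i> ^ 3 = - \<i>" by (simp add: numeral_3_eq_3)
  ultimately show False
    using *[of 0] *[of 1] *[of 2] *[of 3] by auto
qed

text \<open>Boundary points come from free arcs or from the long sides of bands, both away from
  diameters and cores; hence the added cones avoid the loop.\<close>

lemma ribbon_boundaryD:
  assumes "p \<in> ribbon_boundary w \<phi>"
  shows "off_loop p" "p \<in> topspace (ribbon w \<phi>)"
proof -
  obtain q z where q: "p = attach w \<phi> (q, z)" and
    "(\<exists>x\<in>set w. q = Disc x \<and> z \<in> free_arcs) \<or> (\<exists>i<length w. q = Band i \<and> z \<in> band_rect \<and> \<bar>Im z\<bar> = 1)"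
    using assms by (auto simp: ribbon_boundary_def)
  then consider (1) x where "x \<in> set w" "q = Disc x" "z \<in> free_arcs"
    | (2) i where "i < length w" "q = Band i" "z \<in> band_rect" "\<bar>Im z\<bar> = 1"
    by blast
  then have "off_loop p \<and> p \<in> topspace (ribbon w \<phi>)"
  proof cases
    case 1
    have "attach w \<phi> (q, z) \<in> topspace (ribbon w \<phi>)"
      using 1 by (intro attach_in_ribbon) (auto simp: free_arcs_def)
    then show ?thesis using 1 free_arcs_quad by (auto simp: q off_loop_def)
  next
    case 2
    have "attach w \<phi> (q, z) \<in> topspace (ribbon w \<phi>)"
      using 2 by (intro attach_in_ribbon) auto
    then show ?thesis using 2 by (auto simp: q off_loop_attach_Band)
  qed
  then show "off_loop p" "p \<in> topspace (ribbon w \<phi>)" by auto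
qed

lemma topspace_collared_ribbon:
  "(p, t) \<in> topspace (collared_ribbon w \<phi>) \<longleftrightarrow>
     p \<in> topspace (ribbon w \<phi>) \<and> 0 \<le> t \<and> t \<le> 1 \<and> (t = 0 \<or> p \<in> ribbon_boundary w \<phi>)"
  by (auto simp: collared_ribbon_def dest: ribbon_boundaryD)

lemma topspace_surface: "topspace (surface w \<phi>) = collapse w \<phi> ` topspace (collared_ribbon w \<phi>)"
  by (simp add: surface_def)

text \<open>At level \<open>1\<close> the surface point is a whole boundary component, which
  contains \<open>p\<close> because \<open>p\<close> is then a boundary point.\<close>

lemma self_in_collapse:
  assumes "(p, t) \<in> topspace (collared_ribbon w \<phi>)"
  shows "(p, t) \<in> collapse w \<phi> (p, t)"
  using assms by (auto simp: collapse_def topspace_collared_ribbon connected_component_of_refl)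

lemma in_collapseD:
  assumes "(q, s) \<in> collapse w \<phi> (p, t)"
  shows "s = t \<and> (q = p \<or> connected_component_of (subtopology (ribbon w \<phi>) (ribbon_boundary w \<phi>)) p q)"
  using assms by (auto simp: collapse_def split: if_splits)

lemma collapse_0 [simp]: "collapse w \<phi> (p, 0) = {(p, 0)}"
  by (simp add: collapse_def)

lemma surface_pt_eq: "surface_pt w \<phi> p z = {(attach w \<phi> (p, z), 0)}"
  by (simp add: surface_pt_def)

text \<open>Openness in the quotient is tested on the pieces, where the preimage is a pair of
  opposite quadrants or half of a band. Compatibility ensures this at the glued ends.\<close>

lemma openin_ribbon_colour:
  assumes "compatible w \<phi> \<kappa>"
  shows "openin (ribbon w \<phi>) {p \<in> topspace (ribbon w \<phi>). off_loop p \<and> ribbon_colour w \<phi> \<kappa> p = c}"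
    (is "openin _ ?B")
proof -
  have "openin (top_of_set (piece_set p)) {z. (p, z) \<in> topspace (pieces w) \<and> attach w \<phi> (p, z) \<in> ?B}"
    if p: "p \<in> Disc ` set w \<union> Band ` {..<length w}" for p
  proof (cases p)
    case (Disc x)
    have "{z. (p, z) \<in> topspace (pieces w) \<and> attach w \<phi> (p, z) \<in> ?B}
        = piece_set p \<inter> {z. if \<kappa> x = c then quad z > 0 else quad z < 0}"
      using p attach_in_ribbon[OF p, of _ \<phi>] Disc
      by (auto simp: topspace_pieces off_loop_def ribbon_colour_def disc_colour_def opp_colour_conv)
    moreover have "open {z. if \<kappa> x = c then quad z > 0 else quad z < 0}"
      unfolding quad_def by (cases "\<kappa> x = c") (auto intro!: open_Collect_less continuous_intros)
    ultimately show ?thesis by (simp add: openin_open_Int)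
  next
    case (Band i)
    have "{z. (p, z) \<in> topspace (pieces w) \<and> attach w \<phi> (p, z) \<in> ?B}
        = piece_set p \<inter> {z. if left_colour w \<phi> \<kappa> i = c then Im z > 0 else Im z < 0}"
      using p attach_in_ribbon[OF p, of _ \<phi>] Band
      by (auto simp: topspace_pieces off_loop_attach_Band ribbon_colour_attach_Band[OF assms]
          band_colour_def opp_colour_conv split: if_splits)
    moreover have "open {z. if left_colour w \<phi> \<kappa> i = c then Im z > 0 else Im z < 0}"
      by (cases "left_colour w \<phi> \<kappa> i = c") (auto intro!: open_Collect_less continuous_intros)
    ultimately show ?thesis by (simp add: openin_open_Int)
  qed
  then have "openin (pieces w) {q \<in> topspace (pieces w). attach w \<phi> q \<in> ?B}"
    unfolding pieces_def openin_sum_topology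
    by (auto simp: pieces_def[symmetric] topspace_pieces)
  then show ?thesis
    unfolding ribbon_def openin_quotient_topology by auto
qed

text \<open>A surface point is a set of representatives; for compatible colours any member serves,
  by \<open>ribbon_colour_component\<close>.\<close>

definition surface_colour ::
  "'a list \<Rightarrow> (nat \<Rightarrow> frame) \<Rightarrow> ('a \<Rightarrow> colour) \<Rightarrow> 'a surface_point \<Rightarrow> colour" where
  "surface_colour w \<phi> \<kappa> = (\<lambda>P\<in>complement w \<phi>. ribbon_colour w \<phi> \<kappa> (fst (SOME q. q \<in> P)))"

text \<open>The two colour classes are disjoint open sets covering the boundary, so a connected
  subset of it cannot meet both.\<close>

lemma ribbon_colour_component:
  assumes "compatible w \<phi> \<kappa>"
    and "connected_component_of (subtopology (ribbon w \<phi>) (ribbon_boundary w \<phi>)) p q"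
  shows "ribbon_colour w \<phi> \<kappa> p = ribbon_colour w \<phi> \<kappa> q"
proof (rule ccontr)
  assume neq: "ribbon_colour w \<phi> \<kappa> p \<noteq> ribbon_colour w \<phi> \<kappa> q"
  define B where "B c = {p \<in> topspace (ribbon w \<phi>). off_loop p \<and> ribbon_colour w \<phi> \<kappa> p = c}" for c
  obtain T where T: "connectedin (ribbon w \<phi>) T" "T \<subseteq> ribbon_boundary w \<phi>" "p \<in> T" "q \<in> T"
    using assms(2) by (auto simp: connected_component_of_def connectedin_subtopology)
  have "openin (ribbon w \<phi>) (B c)" for c
    unfolding B_def by (rule openin_ribbon_colour[OF assms(1)])
  moreover have "T \<subseteq> B (ribbon_colour w \<phi> \<kappa> p) \<union> B (ribbon_colour w \<phi> \<kappa> q)"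
  proof
    fix r assume "r \<in> T"
    then have "off_loop r" "r \<in> topspace (ribbon w \<phi>)"
      using T(2) ribbon_boundaryD[of r] by auto
    moreover have "ribbon_colour w \<phi> \<kappa> r = ribbon_colour w \<phi> \<kappa> p \<or> ribbon_colour w \<phi> \<kappa> r = ribbon_colour w \<phi> \<kappa> q"
      using neq by (metis (full_types) colour.exhaust)
    ultimately show "r \<in> B (ribbon_colour w \<phi> \<kappa> p) \<union> B (ribbon_colour w \<phi> \<kappa> q)"
      by (auto simp: B_def)
  qed
  moreover have "B (ribbon_colour w \<phi> \<kappa> p) \<inter> B (ribbon_colour w \<phi> \<kappa> q) \<inter> T = {}"
    using neq by (auto simp: B_def)
  moreover have "B (ribbon_colour w \<phi> \<kappa> p) \<inter> T \<noteq> {}" "B (ribbon_colour w \<phi> \<kappa> q) \<inter> T \<noteq> {}"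
    using T(2-4) ribbon_boundaryD[of p w \<phi>] ribbon_boundaryD[of q w \<phi>]
    unfolding B_def by blast+
  ultimately show False
    using T(1) unfolding connectedin by blast
qed

lemma eventually_at_right_ex:
  assumes "\<forall>\<^sub>F h in at_right (0::real). Q h" "0 < e"
  obtains h where "0 < h" "h < e" "Q h"
proof -
  have "\<forall>\<^sub>F h in at_right 0. h \<in> {0<..<e}"
    using assms(2) by (rule eventually_at_right_real)
  with assms(1) have "\<forall>\<^sub>F h in at_right 0. Q h \<and> h \<in> {0<..<e}"
    by (rule eventually_conj)
  then have "\<exists>h. Q h \<and> h \<in> {0<..<e}"
    by (rule eventually_happens'[rotated]) simp
  with that show ?thesis by auto
qed

section \<open>The loop, its complement and the bicolouring built from compatible colours\<close>

locale framed_chord_diagram =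
  fixes w :: "'a list" and \<phi> :: "nat \<Rightarrow> frame"
  assumes chord_diagram: "chord_diagram w" and framing: "\<phi> \<in> framings w"
begin

lemma occurrences:
  assumes "x \<in> set w"
  obtains i j where "{k. k < length w \<and> w ! k = x} = {i, j}" "\<phi> i = Frame_inf" "\<phi> j = Frame_0"
proof -
  have "card {k. k < length w \<and> w ! k = x} = count_list w x"
    by (simp add: count_list_eq_length_filter length_filter_conv_card eq_commute)
  also have "\<dots> = 2"
    using assms chord_diagram by (simp add: chord_diagram_def)
  finally obtain i j where ij: "{k. k < length w \<and> w ! k = x} = {i, j}" "i \<noteq> j"
    by (auto simp: card_2_iff)
  have "i \<in> {k. k < length w \<and> w ! k = x}" "j \<in> {k. k < length w \<and> w ! k = x}"
    by (simp_all only: ij(1) insert_iff simp_thms)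
  then have "i < length w" "j < length w" "w ! i = w ! j"
    by simp_all
  then have "\<phi> i \<noteq> \<phi> j"
    using framing ij(2) by (simp add: framings_def)
  then show ?thesis
    using that[of i j] that[of j i] ij(1) by (cases "\<phi> i"; cases "\<phi> j") (auto simp: insert_commute)
qed

lemma sum_tangent:
  assumes "x \<in> set w"
  shows "(\<Sum>i | i < length w \<and> w ! i = x. tangent \<phi> i) = Complex 1 1"
proof -
  obtain i j where *: "{k. k < length w \<and> w ! k = x} = {i, j}" "\<phi> i = Frame_inf" "\<phi> j = Frame_0"
    using occurrences[OF assms] .
  have "i \<noteq> j"
    using *(2,3) by (metis frame.distinct(1))
  then show ?thesis
    unfolding * by (simp add: tangent_def *(2,3) complex_eq_iff)
qed

text \<open>This replaces the parametrised loop by the vanishing of a coordinate function, so that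
  the complement can be handled without times.\<close>

lemma filoop_image:
  "filoop w \<phi> ` {0..<real (length w)} = (\<lambda>p. {(p, 0)}) ` {p \<in> topspace (ribbon w \<phi>). \<not> off_loop p}"
  (is "?L = ?R")
proof (intro equalityI subsetI)
  fix P assume "P \<in> ?L"
  then obtain t where t: "0 \<le> t" "t < real (length w)" "P = filoop w \<phi> t" by auto
  define i where "i = nat \<lfloor>t\<rfloor> mod length w"
  have "i < length w" unfolding i_def using t by (intro mod_less_divisor) auto
  show "P \<in> ?R"
  proof (cases "frac t < 1/2")
    case True
    define z where "z = of_real (4 * frac t - 1) * tangent \<phi> i"
    have "\<bar>4 * frac t - 1\<bar> \<le> 1"
      using True frac_ge_0[of t] by linarith
    moreover have "cmod z = \<bar>4 * frac t - 1\<bar>"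
      unfolding z_def norm_mult norm_of_real by simp
    ultimately have "attach w \<phi> (Disc (w ! i), z) \<in> topspace (ribbon w \<phi>)"
      using \<open>i < length w\<close> by (intro attach_in_ribbon) simp_all
    moreover have "quad z = 0"
      by (simp add: z_def quad_def tangent_def)
    moreover have "P = {((Disc (w ! i), z), 0)}"
      using True by (simp add: t(3) filoop_def Let_def i_def z_def surface_pt_eq)
    ultimately show ?thesis by (auto simp: off_loop_def)
  next
    case False
    define z where "z = complex_of_real (2 * frac t - 1)"
    have z: "z \<in> band_rect"
      using False frac_lt_1[of t] by (auto simp: z_def band_rect_def)
    have "attach w \<phi> (Band i, z) \<in> topspace (ribbon w \<phi>)"
      using \<open>i < length w\<close> z by (intro attach_in_ribbon) auto
    moreover have "\<not> off_loop (attach w \<phi> (Band i, z))"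
      using z by (simp add: off_loop_attach_Band) (simp add: z_def)
    moreover have "P = {(attach w \<phi> (Band i, z), 0)}"
      using False by (simp add: t(3) filoop_def Let_def i_def z_def surface_pt_eq)
    ultimately show ?thesis by auto
  qed
next
  fix P assume "P \<in> ?R"
  then obtain p where p: "p \<in> topspace (ribbon w \<phi>)" "\<not> off_loop p" "P = {(p, 0)}" by auto
  have time: "filoop w \<phi> (real i + s) \<in> ?L" "nat \<lfloor>real i + s\<rfloor> mod length w = i" "frac (real i + s) = s"
    if "i < length w" "0 \<le> s" "s < 1" for i s
  proof -
    have "real i + s < real (length w)"
      using that by linarith
    then show "filoop w \<phi> (real i + s) \<in> ?L" using that by auto
    have "\<lfloor>real i + s\<rfloor> = int i" using that by (simp add: floor_unique)
    then show "nat \<lfloor>real i + s\<rfloor> mod length w = i" "frac (real i + s) = s"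
      using that by (simp_all add: frac_def)
  qed
  show "P \<in> ?L"
    using p(1)
  proof (cases rule: ribbon_cases)
    case (1 x z)
    obtain k l where kl: "{k. k < length w \<and> w ! k = x} = {k, l}" "\<phi> k = Frame_inf" "\<phi> l = Frame_0"
      using occurrences[OF 1(2)] .
    have "Re z = 0 \<or> Im z = 0"
      using p(2) 1 by (auto simp: off_loop_def quad_def)
    \<comment> \<open>A real \<open>z\<close> lies on the diameter of the occurrence with frame
      \<open>Frame_inf\<close>, an imaginary one on that of the other occurrence.\<close>
    then obtain i where i: "i < length w" "w ! i = x" and "\<exists>r. z = of_real r * tangent \<phi> i"
    proof
      assume "Re z = 0"
      then have "z = of_real (Im z) * tangent \<phi> l" by (simp add: tangent_def kl complex_eq_iff)
      then show ?thesis using that[of l] kl(1) by blast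
    next
      assume "Im z = 0"
      then have "z = of_real (Re z) * tangent \<phi> k" by (simp add: tangent_def kl complex_eq_iff)
      then show ?thesis using that[of k] kl(1) by blast
    qed
    then obtain r where r: "z = of_real r * tangent \<phi> i" by blast
    then have "\<bar>r\<bar> \<le> 1" using 1(3) by (simp add: norm_mult)
    show ?thesis
    \<comment> \<open>The end of a diameter is excluded from its half-open time interval; it is
      reached at time \<open>i + 1/2\<close> as the start of the band core.\<close>
    proof (cases "r = 1")
      case True
      have "filoop w \<phi> (real i + 1/2) = P"
        using time[of i "1/2"] i True by (simp add: filoop_def surface_pt_eq p(3) 1(1) attach_Band_left r)
      then show ?thesis using time(1)[of i "1/2"] i by auto
    next
      case False
      define s where "s = (r + 1) / 4"
      have s: "0 \<le> s" "s < 1 / 2" "4 * s - 1 = r"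
        using False \<open>\<bar>r\<bar> \<le> 1\<close> by (auto simp: s_def field_simps)
      have "filoop w \<phi> (real i + s) = P"
        using time[of i s] i s unfolding filoop_def Let_def by (simp add: surface_pt_eq p(3) 1(1) r del: of_real_diff)
      then show ?thesis using time(1)[of i s] i s by auto
    qed
  next
    case (2 i z)
    define s where "s = (Re z + 1) / 2"
    have "Im z = 0" using p(2) 2 by (simp add: off_loop_def)
    have s: "1 / 2 \<le> s" "s < 1" "2 * s - 1 = Re z"
      using 2 by (auto simp: s_def band_rect_def field_simps)
    have z: "complex_of_real (Re z) = z" using \<open>Im z = 0\<close> by (simp add: complex_eq_iff)
    have "filoop w \<phi> (real i + s) = P"
      using time(2,3)[of i s] 2 s unfolding filoop_def Let_def
      by (simp add: surface_pt_eq p(3) 2(1) z attach_Band_inside del: of_real_diff)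
    then show ?thesis using time(1)[of i s] 2 s by auto
  qed
qed

text \<open>A point on the loop is no boundary point, so it sits at level \<open>0\<close> and its
  collapse is a singleton. A point off the loop belongs to its own collapse, which therefore is not
  the singleton of a loop point.\<close>

lemma collapse_complement_iff:
  assumes "(p, t) \<in> topspace (collared_ribbon w \<phi>)"
  shows "collapse w \<phi> (p, t) \<in> complement w \<phi> \<longleftrightarrow> off_loop p"
proof
  assume P: "collapse w \<phi> (p, t) \<in> complement w \<phi>"
  show "off_loop p"
  proof (rule ccontr)
    assume "\<not> off_loop p"
    then have "t = 0" "p \<in> topspace (ribbon w \<phi>)"
      using assms ribbon_boundaryD(1)[of p w \<phi>] by (auto simp: topspace_collared_ribbon)
    with \<open>\<not> off_loop p\<close> P show False
      by (simp add: complement_def filoop_image)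
  qed
next
  assume "off_loop p"
  then have "(p, t) \<notin> {(q, 0)}" if "\<not> off_loop q" for q
    using that by auto
  then have "collapse w \<phi> (p, t) \<noteq> {(q, 0)}" if "\<not> off_loop q" for q
    using self_in_collapse[OF assms] that by metis
  moreover have "collapse w \<phi> (p, t) \<in> topspace (surface w \<phi>)"
    using assms by (simp add: topspace_surface)
  ultimately show "collapse w \<phi> (p, t) \<in> complement w \<phi>"
    unfolding complement_def filoop_image by blast
qed

lemma complement_iff:
  "P \<in> complement w \<phi> \<longleftrightarrow>
    (\<exists>p t. (p, t) \<in> topspace (collared_ribbon w \<phi>) \<and> off_loop p \<and> P = collapse w \<phi> (p, t))"
proof
  assume P: "P \<in> complement w \<phi>"
  then obtain p t where p: "(p, t) \<in> topspace (collared_ribbon w \<phi>)" "P = collapse w \<phi> (p, t)"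
    by (auto simp: complement_def topspace_surface)
  with P have "off_loop p" by (simp add: collapse_complement_iff)
  with p show "\<exists>p t. (p, t) \<in> topspace (collared_ribbon w \<phi>) \<and> off_loop p \<and> P = collapse w \<phi> (p, t)"
    by blast
qed (use collapse_complement_iff in blast)

lemma surface_pt_complement:
  assumes "p \<in> Disc ` set w \<union> Band ` {..<length w}" "z \<in> piece_set p" "off_loop (attach w \<phi> (p, z))"
  shows "surface_pt w \<phi> p z \<in> complement w \<phi>"
proof -
  have "(attach w \<phi> (p, z), 0) \<in> topspace (collared_ribbon w \<phi>)"
    using attach_in_ribbon[OF assms(1,2), of \<phi>] by (simp add: topspace_collared_ribbon)
  with assms(3) show ?thesis
    unfolding complement_iff surface_pt_def by blast
qed

text \<open>The ribbon coordinate of the member chosen by \<open>SOME\<close> is \<open>p\<close> or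
  lies in the boundary component of \<open>p\<close>, where the colour is constant.\<close>

lemma surface_colour_collapse:
  assumes "compatible w \<phi> \<kappa>" "(p, t) \<in> topspace (collared_ribbon w \<phi>)" "off_loop p"
  shows "surface_colour w \<phi> \<kappa> (collapse w \<phi> (p, t)) = ribbon_colour w \<phi> \<kappa> p"
proof -
  define q where "q = (SOME q. q \<in> collapse w \<phi> (p, t))"
  have "q \<in> collapse w \<phi> (p, t)"
    unfolding q_def by (rule someI) (rule self_in_collapse[OF assms(2)])
  then have "fst q = p \<or> connected_component_of (subtopology (ribbon w \<phi>) (ribbon_boundary w \<phi>)) p (fst q)"
    by (cases q) (auto dest: in_collapseD)
  then have "ribbon_colour w \<phi> \<kappa> (fst q) = ribbon_colour w \<phi> \<kappa> p"
    using ribbon_colour_component[OF assms(1)] by metis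
  moreover have "collapse w \<phi> (p, t) \<in> complement w \<phi>"
    unfolding complement_iff using assms by blast
  ultimately show ?thesis
    by (simp add: surface_colour_def q_def)
qed

lemma surface_colour_pt:
  assumes "compatible w \<phi> \<kappa>" "p \<in> Disc ` set w \<union> Band ` {..<length w}" "z \<in> piece_set p"
    "off_loop (attach w \<phi> (p, z))"
  shows "surface_colour w \<phi> \<kappa> (surface_pt w \<phi> p z) = ribbon_colour w \<phi> \<kappa> (attach w \<phi> (p, z))"
  unfolding surface_pt_def using assms attach_in_ribbon[OF assms(2,3), of \<phi>]
  by (intro surface_colour_collapse) (simp_all add: topspace_collared_ribbon)

lemma surface_colour_Disc:
  assumes "compatible w \<phi> \<kappa>" "x \<in> set w" "cmod z \<le> 1" "quad z \<noteq> 0"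
  shows "surface_colour w \<phi> \<kappa> (surface_pt w \<phi> (Disc x) z) = disc_colour \<kappa> x z"
  using surface_colour_pt[OF assms(1), of "Disc x" z] assms by (simp add: off_loop_def ribbon_colour_def)

lemma surface_colour_Band:
  assumes "compatible w \<phi> \<kappa>" "i < length w" "z \<in> band_rect" "Im z \<noteq> 0"
  shows "surface_colour w \<phi> \<kappa> (surface_pt w \<phi> (Band i) z) = band_colour w \<phi> \<kappa> i z"
  using surface_colour_pt[OF assms(1), of "Band i" z] assms
  by (simp add: off_loop_attach_Band ribbon_colour_attach_Band)

text \<open>The colour does not depend on the level, so the preimage under \<open>collapse\<close>
  is the part of the cylinder \<open>B \<times> {0..1}\<close> inside the collared ribbon.\<close>

lemma openin_surface_colour:
  assumes "compatible w \<phi> \<kappa>"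
  shows "openin (surface w \<phi>) {P \<in> complement w \<phi>. surface_colour w \<phi> \<kappa> P = c}" (is "openin _ ?U")
proof -
  define B where "B = {p \<in> topspace (ribbon w \<phi>). off_loop p \<and> ribbon_colour w \<phi> \<kappa> p = c}"
  have "(p, t) \<in> topspace (collared_ribbon w \<phi>) \<and> collapse w \<phi> (p, t) \<in> ?U \<longleftrightarrow>
      (p, t) \<in> B \<times> {0..1} \<and> (p, t) \<in> topspace (collared_ribbon w \<phi>)" for p t
  proof (cases "(p, t) \<in> topspace (collared_ribbon w \<phi>) \<and> off_loop p")
    case True
    then have "p \<in> topspace (ribbon w \<phi>)" "t \<in> {0..1}"
      by (simp_all add: topspace_collared_ribbon)
    with True show ?thesis
      using surface_colour_collapse[OF assms, of p t] collapse_complement_iff[of p t] by (simp add: B_def)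
  next
    case False
    then show ?thesis
      using collapse_complement_iff[of p t] by (auto simp: B_def)
  qed
  then have "{q \<in> topspace (collared_ribbon w \<phi>). collapse w \<phi> q \<in> ?U}
      = (B \<times> {0..1}) \<inter> topspace (collared_ribbon w \<phi>)"
    by (intro set_eqI) (simp only: split_paired_all mem_Collect_eq Int_iff)
  moreover have "openin (prod_topology (ribbon w \<phi>) (top_of_set {0..1::real})) (B \<times> {0..1})"
    using openin_ribbon_colour[OF assms, of c] by (simp add: openin_prod_Times_iff B_def)
  ultimately have "openin (collared_ribbon w \<phi>) {q \<in> topspace (collared_ribbon w \<phi>). collapse w \<phi> q \<in> ?U}"
    unfolding collared_ribbon_def by (auto simp: openin_subtopology)
  moreover have "?U \<subseteq> collapse w \<phi> ` topspace (collared_ribbon w \<phi>)"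
    by (auto simp: complement_iff)
  ultimately show ?thesis
    unfolding surface_def openin_quotient_topology by blast
qed

text \<open>Openness of both colour classes makes the colour constant on components; crossing the
  loop reverses the sign of \<open>Im\<close> in a band and of \<open>quad\<close> in a
  disc.\<close>

lemma surface_colour_bicolouring:
  assumes "compatible w \<phi> \<kappa>"
  shows "surface_colour w \<phi> \<kappa> \<in> region_bicolourings w \<phi>"
proof -
  let ?b = "surface_colour w \<phi> \<kappa>"
  have 1: "?b \<in> complement w \<phi> \<rightarrow>\<^sub>E UNIV"
    by (simp add: surface_colour_def)
  have 2: "?b p = ?b q" if "K \<in> connected_components_of (subtopology (surface w \<phi>) (complement w \<phi>))"
    "p \<in> K" "q \<in> K" for K p q
  proof (rule ccontr)
    assume neq: "?b p \<noteq> ?b q"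
    have K: "connectedin (surface w \<phi>) K" "K \<subseteq> complement w \<phi>"
      using connectedin_connected_components_of[OF that(1)] by (auto simp: connectedin_subtopology)
    define U where "U c = {P \<in> complement w \<phi>. ?b P = c}" for c
    have "openin (surface w \<phi>) (U c)" for c
      unfolding U_def by (rule openin_surface_colour[OF assms])
    moreover have "K \<subseteq> U (?b p) \<union> U (?b q)"
    proof
      fix r assume "r \<in> K"
      moreover have "?b r = ?b p \<or> ?b r = ?b q"
        using neq by (metis (full_types) colour.exhaust)
      ultimately show "r \<in> U (?b p) \<union> U (?b q)"
        using K(2) by (auto simp: U_def)
    qed
    moreover have "U (?b p) \<inter> U (?b q) \<inter> K = {}" "U (?b p) \<inter> K \<noteq> {}" "U (?b q) \<inter> K \<noteq> {}"
      using neq that K(2) by (auto simp: U_def)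
    ultimately show False
      using K(1) unfolding connectedin by blast
  qed
  have 3: "\<forall>\<^sub>F h in at_right 0. ?b (surface_pt w \<phi> (Band i) (Complex s h)) \<noteq>
        ?b (surface_pt w \<phi> (Band i) (Complex s (- h)))" if "i < length w" "s \<in> {0..1}" for i s
  proof (rule eventually_at_rightI[of 0 1])
    fix h :: real assume "h \<in> {0<..<1}"
    then show "?b (surface_pt w \<phi> (Band i) (Complex s h)) \<noteq> ?b (surface_pt w \<phi> (Band i) (Complex s (- h)))"
      using that by (subst (1 2) surface_colour_Band[OF assms]) (auto simp: band_rect_def band_colour_def)
  qed simp
  have 4: "\<forall>\<^sub>F h in at_right 0. ?b (surface_pt w \<phi> (Disc (w ! i)) (tangent \<phi> i * Complex r h)) \<noteq>
        ?b (surface_pt w \<phi> (Disc (w ! i)) (tangent \<phi> i * Complex r (- h)))"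
    if "i < length w" "r \<in> {-1<..<1} - {0}" for i r
  \<comment> \<open>Below this bound both points lie in the disc, since the norm is at most the sum
    of the absolute values of the coordinates.\<close>
  proof (rule eventually_at_rightI[of 0 "1 - \<bar>r\<bar>"])
    fix h :: real assume h: "h \<in> {0<..<1 - \<bar>r\<bar>}"
    have n: "cmod (tangent \<phi> i * Complex r h) \<le> 1" "cmod (tangent \<phi> i * Complex r (- h)) \<le> 1"
      using h cmod_le[of "Complex r h"] cmod_le[of "Complex r (- h)"] by (simp_all add: norm_mult)
    have q: "quad (Complex r h) = r * h" "quad (Complex r (-h)) = - (r * h)" "r * h \<noteq> 0"
      using h that by (simp_all add: quad_def)
    have "r * h > 0 \<or> r * h < 0" using q(3) by linarith
    then show "?b (surface_pt w \<phi> (Disc (w ! i)) (tangent \<phi> i * Complex r h)) \<noteq>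
        ?b (surface_pt w \<phi> (Disc (w ! i)) (tangent \<phi> i * Complex r (- h)))"
      using surface_colour_Disc[OF assms, of "w ! i" "tangent \<phi> i * Complex r h"]
        surface_colour_Disc[OF assms, of "w ! i" "tangent \<phi> i * Complex r (- h)"] that(1) q n
      by (auto simp: quad_tangent disc_colour_def)
  qed (use that in auto)
  show ?thesis
    unfolding region_bicolourings_def
    by (intro CollectI conjI ballI allI impI) (rule 1, erule (2) 2, erule (1) 3, erule (1) 4)
qed

section \<open>Bicolourings are determined by one colour per chord\<close>

lemma bicolouring_const_on_connected:
  assumes b: "b \<in> region_bicolourings w \<phi>"
    and "connectedin (surface w \<phi>) T" "T \<subseteq> complement w \<phi>" "P \<in> T" "Q \<in> T"
  shows "b P = b Q"
proof -
  let ?X = "subtopology (surface w \<phi>) (complement w \<phi>)"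
  have T: "connectedin ?X T"
    using assms by (simp add: connectedin_subtopology)
  then have "P \<in> topspace ?X"
    using assms(4) connectedin_subset_topspace by blast
  then have "connected_component_of_set ?X P \<in> connected_components_of ?X"
    by (simp add: connected_components_of_def)
  moreover have "P \<in> connected_component_of_set ?X P" "Q \<in> connected_component_of_set ?X P"
    using T assms(4,5) unfolding connected_component_of_def by blast+
  moreover have "\<forall>K \<in> connected_components_of ?X. \<forall>p\<in>K. \<forall>q\<in>K. b p = b q"
    using b unfolding region_bicolourings_def by (elim CollectE conjE)
  ultimately show ?thesis by (elim ballE) blast+
qed

lemma continuous_map_surface_pt:
  assumes "p \<in> Disc ` set w \<union> Band ` {..<length w}"
  shows "continuous_map (top_of_set (piece_set p)) (surface w \<phi>) (surface_pt w \<phi> p)"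
proof -
  have "continuous_map (top_of_set (piece_set p)) (pieces w) (Pair p)"
    unfolding pieces_def using assms by (rule continuous_map_component_injection)
  moreover have "continuous_map (pieces w) (ribbon w \<phi>) (attach w \<phi>)"
    unfolding ribbon_def by (intro quotient_imp_continuous_map quotient_map_quotient_topology)
  moreover have "continuous_map (ribbon w \<phi>) (collared_ribbon w \<phi>) (\<lambda>p. (p, 0))"
    unfolding collared_ribbon_def continuous_map_in_subtopology
    by (auto intro!: continuous_map_pairedI)
  moreover have "continuous_map (collared_ribbon w \<phi>) (surface w \<phi>) (collapse w \<phi>)"
    unfolding surface_def by (intro quotient_imp_continuous_map quotient_map_quotient_topology)
  ultimately have "continuous_map (top_of_set (piece_set p)) (surface w \<phi>)
      (collapse w \<phi> \<circ> ((\<lambda>p. (p, 0)) \<circ> (attach w \<phi> \<circ> Pair p)))"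
    by (intro continuous_map_compose)
  then show ?thesis
    by (simp add: surface_pt_def[abs_def] comp_def)
qed

text \<open>Convex sets have connected images in the surface; this will be applied to the open
  quadrants of a disc and the halves of a band.\<close>

lemma bicolouring_const_on_piece:
  assumes "b \<in> region_bicolourings w \<phi>" "p \<in> Disc ` set w \<union> Band ` {..<length w}"
    and "convex S" "S \<subseteq> piece_set p" "\<And>z. z \<in> S \<Longrightarrow> off_loop (attach w \<phi> (p, z))"
    and "y \<in> S" "z \<in> S"
  shows "b (surface_pt w \<phi> p y) = b (surface_pt w \<phi> p z)"
proof (rule bicolouring_const_on_connected[OF assms(1)])
  have "connectedin (top_of_set (piece_set p)) S"
    using assms(3,4) by (simp add: connectedin_subtopology convex_connected)
  then show "connectedin (surface w \<phi>) (surface_pt w \<phi> p ` S)"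
    by (rule connectedin_continuous_map_image[OF continuous_map_surface_pt[OF assms(2)]])
  show "surface_pt w \<phi> p ` S \<subseteq> complement w \<phi>"
    using assms(2,4,5) by (intro image_subsetI surface_pt_complement) auto
qed (use assms in auto)

text \<open>Every point of the disc glued to a boundary circle lies on a ray of the cone.\<close>

lemma bicolouring_cone:
  assumes b: "b \<in> region_bicolourings w \<phi>" and p: "(p, t) \<in> topspace (collared_ribbon w \<phi>)" "off_loop p"
  shows "b (collapse w \<phi> (p, t)) = b {(p, 0)}"
proof (cases "t = 0")
  case False
  with p have pB: "p \<in> ribbon_boundary w \<phi>" and t: "t \<in> {0..1}"
    by (auto simp: topspace_collared_ribbon)
  let ?f = "\<lambda>t::real. (p, t)"
  have coll: "?f s \<in> topspace (collared_ribbon w \<phi>)" if "s \<in> {0..1}" for s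
    using that pB ribbon_boundaryD[OF pB] by (auto simp: topspace_collared_ribbon)
  have "continuous_map (top_of_set {0..1}) (collared_ribbon w \<phi>) ?f"
    unfolding collared_ribbon_def continuous_map_in_subtopology
    using pB ribbon_boundaryD(2)[OF pB] by (auto intro!: continuous_map_pairedI)
  moreover have "continuous_map (collared_ribbon w \<phi>) (surface w \<phi>) (collapse w \<phi>)"
    unfolding surface_def by (intro quotient_imp_continuous_map quotient_map_quotient_topology)
  ultimately have "continuous_map (top_of_set {0..1}) (surface w \<phi>) (collapse w \<phi> \<circ> ?f)"
    by (rule continuous_map_compose)
  moreover have "connectedin (top_of_set {0..1::real}) {0..1}"
    by (simp add: connectedin_subtopology)
  ultimately have "connectedin (surface w \<phi>) ((collapse w \<phi> \<circ> ?f) ` {0..1})"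
    by (rule connectedin_continuous_map_image)
  moreover have "(collapse w \<phi> \<circ> ?f) ` {0..1} \<subseteq> complement w \<phi>"
    using coll p(2) by (auto simp: collapse_complement_iff)
  ultimately have "b ((collapse w \<phi> \<circ> ?f) t) = b ((collapse w \<phi> \<circ> ?f) 0)"
    by (rule bicolouring_const_on_connected[OF b _ _ imageI imageI]) (use t in simp_all)
  then show ?thesis by simp
qed simp

text \<open>The sample point lies in the quadrant of the sum of the tangent vectors, so this is the
  only candidate for a chord colouring from which \<open>b\<close> arises.\<close>

definition corner_colouring :: "('a surface_point \<Rightarrow> colour) \<Rightarrow> 'a \<Rightarrow> colour" where
  "corner_colouring b = (\<lambda>x\<in>set w. b (surface_pt w \<phi> (Disc x) (Complex (1/2) (1/2))))"

text \<open>Each open quadrant, cut down to the disc, is convex and gets one colour. Crossing a half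
  diameter changes the colour, so with two colours opposite quadrants agree.\<close>

lemma bicolouring_Disc:
  assumes b: "b \<in> region_bicolourings w \<phi>" and x: "x \<in> set w" and z: "cmod z \<le> 1" "quad z \<noteq> 0"
  shows "b (surface_pt w \<phi> (Disc x) z) = disc_colour (corner_colouring b) x z"
proof -
  let ?B = "\<lambda>z. b (surface_pt w \<phi> (Disc x) z)"
  \<comment> \<open>Only the signs of \<sigma> and \<tau> matter; they select the quadrant
    containing both points.\<close>
  have same: "?B y = ?B y'" if "cmod y \<le> 1" "cmod y' \<le> 1" "0 < \<sigma> * Re y" "0 < \<sigma> * Re y'"
    "0 < \<tau> * Im y" "0 < \<tau> * Im y'" for y y' and \<sigma> \<tau> :: real
  proof (rule bicolouring_const_on_piece[OF b, of "Disc x" "cball 0 1 \<inter> ({z. 0 < \<sigma> * Re z} \<inter> {z. 0 < \<tau> * Im z})"])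
    have "{z. 0 < \<sigma> * Re z} = {z. of_real \<sigma> \<bullet> z > 0}" "{z. 0 < \<tau> * Im z} = {z. (of_real \<tau> * \<i>) \<bullet> z > 0}"
      by (auto simp: inner_complex_def mult.commute)
    then show "convex (cball 0 1 \<inter> ({z. 0 < \<sigma> * Re z} \<inter> {z. 0 < \<tau> * Im z}))"
      by (simp add: convex_Int convex_halfspace_gt)
    show "off_loop (attach w \<phi> (Disc x, z))" if "z \<in> cball 0 1 \<inter> ({z. 0 < \<sigma> * Re z} \<inter> {z. 0 < \<tau> * Im z})" for z
      using that by (auto simp: off_loop_def quad_def)
  qed (use that x in auto)
  have small: "cmod (Complex r s) \<le> 1" if "\<bar>r\<bar> \<le> 1/2" "\<bar>s\<bar> \<le> 1/2" for r s
    using cmod_le[of "Complex r s"] that by simp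
  have cross: "?B (tangent \<phi> i * Complex r (1/2)) \<noteq> ?B (tangent \<phi> i * Complex r (- (1/2)))"
    if i: "i < length w" "w ! i = x" and r: "\<bar>r\<bar> = 1/2" for i r
  proof -
    have "\<forall>i<length w. \<forall>r\<in>{-1<..<1} - {0}. \<forall>\<^sub>F h in at_right 0.
        b (surface_pt w \<phi> (Disc (w ! i)) (tangent \<phi> i * Complex r h)) \<noteq>
        b (surface_pt w \<phi> (Disc (w ! i)) (tangent \<phi> i * Complex r (- h)))"
      using b unfolding region_bicolourings_def by (elim CollectE conjE)
    moreover have "r \<in> {-1<..<1} - {0}"
      using r by auto
    ultimately have "\<forall>\<^sub>F h in at_right 0. ?B (tangent \<phi> i * Complex r h) \<noteq> ?B (tangent \<phi> i * Complex r (- h))"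
      using i by blast
    \<comment> \<open>The crossing condition holds at some small \<open>h\<close>; constancy on the
      quadrants then moves both points to distance \<open>1/2\<close> from the diameter.\<close>
    then obtain h where h: "0 < h" "h < 1/2" "?B (tangent \<phi> i * Complex r h) \<noteq> ?B (tangent \<phi> i * Complex r (- h))"
      by (rule eventually_at_right_ex[where e = "1/2"]) auto
    have c: "cmod (Complex r h) \<le> 1" "cmod (Complex r (1/2)) \<le> 1"
      "cmod (Complex r (- h)) \<le> 1" "cmod (Complex r (- (1/2))) \<le> 1"
      using h r by (intro small; simp)+
    \<comment> \<open>Below, the coordinates of the target point serve as \<sigma> and \<tau>; the
      required products are then positive because squares are.\<close>
    have rr: "0 < r * r"
      using r by (auto simp: zero_less_mult_iff)
    have "?B (tangent \<phi> i * Complex r h) = ?B (tangent \<phi> i * Complex r (1/2))"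
      using c h(1) rr
      by (intro same[of _ _ "Re (tangent \<phi> i * Complex r (1/2))" "Im (tangent \<phi> i * Complex r (1/2))"])
        (simp_all add: norm_mult tangent_def)
    moreover have "?B (tangent \<phi> i * Complex r (- h)) = ?B (tangent \<phi> i * Complex r (- (1/2)))"
      using c h(1) rr
      by (intro same[of _ _ "Re (tangent \<phi> i * Complex r (- (1/2)))" "Im (tangent \<phi> i * Complex r (- (1/2)))"])
        (simp_all add: norm_mult tangent_def)
    ultimately show ?thesis using h(3) by simp
  qed
  obtain i j where "{k. k < length w \<and> w ! k = x} = {i, j}" and ij: "\<phi> i = Frame_inf" "\<phi> j = Frame_0"
    using occurrences[OF x] .
  then have i: "i < length w" "w ! i = x" and j: "j < length w" "w ! j = x"
    by blast+
  have t: "tangent \<phi> i * c = c" "tangent \<phi> j * Complex r s = Complex (- s) r" for c r s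
    by (simp_all add: tangent_def ij complex_eq_iff)
  \<comment> \<open>Three of the four crossings suffice, since with two colours they force the
    fourth.\<close>
  have neq: "?B (Complex (1/2) (1/2)) \<noteq> ?B (Complex (1/2) (-1/2))"
    "?B (Complex (-1/2) (1/2)) \<noteq> ?B (Complex (-1/2) (-1/2))"
    "?B (Complex (-1/2) (1/2)) \<noteq> ?B (Complex (1/2) (1/2))"
    using cross[OF i, of "1/2"] cross[OF i, of "-1/2"] cross[OF j, of "1/2"]
    by (simp_all add: t)
  have corner: "corner_colouring b x = ?B (Complex (1/2) (1/2))"
    using x by (simp add: corner_colouring_def)
  \<comment> \<open>A sample point in the quadrant of \<open>z\<close>.\<close>
  define y where "y = Complex (sgn (Re z) / 2) (sgn (Im z) / 2)"
  have nz: "Re z \<noteq> 0" "Im z \<noteq> 0" using z(2) by (auto simp: quad_def)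
  have "?B z = ?B y"
    using z(1) small[of "sgn (Re z) / 2" "sgn (Im z) / 2"] nz
    by (intro same[of _ _ "sgn (Re z)" "sgn (Im z)"]) (auto simp: y_def sgn_if)
  also have "?B y = disc_colour (corner_colouring b) x z"
    using neq nz unfolding disc_colour_def corner quad_def y_def
    by (cases "0 < Re z"; cases "0 < Im z")
      (auto simp: sgn_if zero_less_mult_iff opp_colour_conv eq_commute[of _ "opp_colour _"], 
        (metis (full_types) colour.exhaust)+)
  finally show ?thesis .
qed

text \<open>Each half of a band is convex, so its colour can be read at its corner on the left end,
  which is a point of the disc of \<open>w ! i\<close>. Comparing the two corners of the left half
  gives the second claim, the hypothesis of \<open>left_colour_compatible\<close>.\<close>

lemma bicolouring_Band:
  assumes b: "b \<in> region_bicolourings w \<phi>" and i: "i < length w" and z: "z \<in> band_rect" "Im z \<noteq> 0"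
  shows "b (surface_pt w \<phi> (Band i) z) = band_colour w \<phi> (corner_colouring b) i z"
    and "left_colour w \<phi> (corner_colouring b) i = (if \<phi> (next_occ w i) = Frame_inf
      then opp_colour (corner_colouring b (w ! next_occ w i)) else corner_colouring b (w ! next_occ w i))"
proof -
  let ?B = "\<lambda>z. b (surface_pt w \<phi> (Band i) z)"
  let ?\<kappa> = "corner_colouring b"
  have same: "?B y = ?B y'" if "y \<in> band_rect" "y' \<in> band_rect" "0 < \<tau> * Im y" "0 < \<tau> * Im y'"
    for y y' and \<tau> :: real
  proof (rule bicolouring_const_on_piece[OF b, of "Band i" "band_rect \<inter> {z. 0 < \<tau> * Im z}"])
    have "band_rect = cbox (Complex 0 (-1)) (Complex 1 1)"
      by (auto simp: band_rect_def in_cbox_complex_iff)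
    then have "convex band_rect"
      by (metis convex_box(1))
    moreover have "{z. 0 < \<tau> * Im z} = {z. (of_real \<tau> * \<i>) \<bullet> z > 0}"
      by (auto simp: inner_complex_def mult.commute)
    ultimately show "convex (band_rect \<inter> {z. 0 < \<tau> * Im z})"
      by (simp add: convex_Int convex_halfspace_gt)
    show "off_loop (attach w \<phi> (Band i, z))" if "z \<in> band_rect \<inter> {z. 0 < \<tau> * Im z}" for z
      using that by (auto simp: off_loop_attach_Band)
  qed (use that i in auto)
  have left: "?B (Complex 0 s) = disc_colour ?\<kappa> (w ! i) (tangent \<phi> i * cis (s * pi / 8))"
    if "\<bar>s\<bar> = 1" for s
  proof -
    have "?B (Complex 0 s) = b (surface_pt w \<phi> (Disc (w ! i)) (tangent \<phi> i * cis (s * pi / 8)))"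
      by (simp add: surface_pt_eq attach_Band_left)
    also have "\<dots> = disc_colour ?\<kappa> (w ! i) (tangent \<phi> i * cis (s * pi / 8))"
      using i that quad_cis(3)[of s] by (intro bicolouring_Disc[OF b]) (auto simp: norm_mult quad_tangent)
    finally show ?thesis .
  qed
  have s: "\<bar>sgn (Im z)\<bar> = 1" using z(2) by (simp add: abs_sgn_eq)
  have "?B z = ?B (Complex 0 (sgn (Im z)))"
    using z by (intro same[of _ _ "sgn (Im z)"]) (auto simp: band_rect_def sgn_if)
  also have "\<dots> = band_colour w \<phi> ?\<kappa> i z"
    using s z(2) quad_cis[of "sgn (Im z)"] unfolding left[OF s]
    by (auto simp: disc_colour_def band_colour_def left_colour_def quad_tangent)
  finally show "?B z = band_colour w \<phi> ?\<kappa> i z" .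
  have "left_colour w \<phi> ?\<kappa> i = ?B (Complex 0 1)"
    using left[of 1] quad_cis[of 1] by (auto simp: disc_colour_def left_colour_def quad_tangent)
  also have "\<dots> = ?B (Complex 1 1)"
    by (intro same[of _ _ 1]) (auto simp: band_rect_def)
  also have "\<dots> = b (surface_pt w \<phi> (Disc (w ! next_occ w i)) (- (tangent \<phi> (next_occ w i) * cis (- (pi / 8)))))"
    by (simp add: surface_pt_eq attach_Band_right)
  also have "\<dots> = disc_colour ?\<kappa> (w ! next_occ w i) (- (tangent \<phi> (next_occ w i) * cis (- (pi / 8))))"
    using next_occ_less[OF i] quad_cis[of 1]
    by (intro bicolouring_Disc[OF b]) (auto simp: norm_mult quad_tangent)
  also have "\<dots> = (if \<phi> (next_occ w i) = Frame_inf
      then opp_colour (?\<kappa> (w ! next_occ w i)) else ?\<kappa> (w ! next_occ w i))"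
    using quad_cis[of 1] by (auto simp: disc_colour_def quad_tangent)
  finally show "left_colour w \<phi> ?\<kappa> i = \<dots>" .
qed

lemma corner_colouring_compatible:
  assumes b: "b \<in> region_bicolourings w \<phi>"
  shows "compatible w \<phi> (corner_colouring b)"
  unfolding compatible_def
proof (intro allI impI)
  fix i assume i: "i < length w"
  show "(\<phi> i = \<phi> (next_occ w i)) \<longleftrightarrow> corner_colouring b (w ! i) \<noteq> corner_colouring b (w ! next_occ w i)"
    by (rule left_colour_compatible, rule bicolouring_Band(2)[OF b i, of "Complex 0 1"])
      (auto simp: band_rect_def)
qed

text \<open>A point of a cone is moved to level \<open>0\<close> by \<open>bicolouring_cone\<close>;
  there the formulas for discs and bands apply.\<close>

lemma surface_colour_corner_colouring:
  assumes b: "b \<in> region_bicolourings w \<phi>"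
  shows "b = surface_colour w \<phi> (corner_colouring b)"
proof (rule PiE_ext)
  show "b \<in> complement w \<phi> \<rightarrow>\<^sub>E UNIV"
    using b by (simp add: region_bicolourings_def)
  show "surface_colour w \<phi> (corner_colouring b) \<in> complement w \<phi> \<rightarrow>\<^sub>E UNIV"
    by (simp add: surface_colour_def)
  fix P assume "P \<in> complement w \<phi>"
  then obtain p t where p: "(p, t) \<in> topspace (collared_ribbon w \<phi>)" "off_loop p" "P = collapse w \<phi> (p, t)"
    unfolding complement_iff by blast
  have "b P = b {(p, 0)}"
    unfolding p(3) by (rule bicolouring_cone[OF b p(1,2)])
  also have "\<dots> = ribbon_colour w \<phi> (corner_colouring b) p"
  proof -
    have "p \<in> topspace (ribbon w \<phi>)" using p(1) by (simp add: topspace_collared_ribbon)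
    then show ?thesis
    proof (cases rule: ribbon_cases)
      case (1 x z)
      then show ?thesis
        using bicolouring_Disc[OF b, of x z] p(2) by (simp add: surface_pt_eq off_loop_def ribbon_colour_def)
    next
      case (2 i z)
      then show ?thesis
        using bicolouring_Band(1)[OF b, of i z] p(2)
        by (simp add: surface_pt_eq off_loop_def ribbon_colour_def attach_Band_inside)
    qed
  qed
  also have "\<dots> = surface_colour w \<phi> (corner_colouring b) P"
    unfolding p(3) by (rule surface_colour_collapse[symmetric, OF corner_colouring_compatible[OF b] p(1,2)])
  finally show "b P = surface_colour w \<phi> (corner_colouring b) P" .
qed

text \<open>Compatible colourings extend over the surface, and the corner colours of a bicolouring
  are compatible and determine it.\<close>

lemma region_bicolourings_eq:
  "region_bicolourings w \<phi> = surface_colour w \<phi> ` {\<kappa> \<in> colourings w. compatible w \<phi> \<kappa>}"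
proof -
  have "corner_colouring b \<in> colourings w" for b
    by (simp add: corner_colouring_def colourings_def)
  then show ?thesis
    using surface_colour_bicolouring corner_colouring_compatible surface_colour_corner_colouring by blast
qed

section \<open>The chord colouring induced by a bicolouring\<close>

lemma surface_colour_sum_direction:
  assumes "compatible w \<phi> \<kappa>" "x \<in> set w"
  shows "\<forall>\<^sub>F r in at_right 0. surface_colour w \<phi> \<kappa> (surface_pt w \<phi> (Disc x)
    (of_real r * (\<Sum>i | i < length w \<and> w ! i = x. tangent \<phi> i))) = \<kappa> x"
proof (rule eventually_at_rightI[of 0 "1/2"])
  \<comment> \<open>Below \<open>1/2\<close> the point \<open>r * (1 + \<i>)\<close> lies in the
    disc, in the quadrant coloured by \<open>\<kappa> x\<close>.\<close>
  fix r :: real assume r: "r \<in> {0<..<1/2}"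
  have "of_real r * Complex 1 1 = Complex r r" by (simp add: complex_eq_iff)
  moreover have "cmod (Complex r r) \<le> 1" using cmod_le[of "Complex r r"] r by simp
  moreover have "quad (Complex r r) > 0" using r by (simp add: quad_def)
  ultimately show "surface_colour w \<phi> \<kappa> (surface_pt w \<phi> (Disc x)
    (of_real r * (\<Sum>i | i < length w \<and> w ! i = x. tangent \<phi> i))) = \<kappa> x"
    unfolding sum_tangent[OF assms(2)] using surface_colour_Disc[OF assms, of "Complex r r"]
    by (simp add: disc_colour_def)
qed simp

lemma induced_surface_colour:
  assumes "compatible w \<phi> \<kappa>" "\<kappa> \<in> colourings w"
  shows "induced_colouring w \<phi> (surface_colour w \<phi> \<kappa>) = \<kappa>"
proof (rule PiE_ext)
  show "induced_colouring w \<phi> (surface_colour w \<phi> \<kappa>) \<in> set w \<rightarrow>\<^sub>E UNIV"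
    by (simp add: induced_colouring_def)
  show "\<kappa> \<in> set w \<rightarrow>\<^sub>E UNIV"
    using assms(2) by (simp add: colourings_def)
  fix x assume x: "x \<in> set w"
  note ev = surface_colour_sum_direction[OF assms(1) x]
  have "(THE c. \<forall>\<^sub>F r in at_right 0. surface_colour w \<phi> \<kappa> (surface_pt w \<phi> (Disc x)
    (of_real r * (\<Sum>i | i < length w \<and> w ! i = x. tangent \<phi> i))) = c) = \<kappa> x"
  proof (rule the_equality, rule ev)
    fix c assume "\<forall>\<^sub>F r in at_right 0. surface_colour w \<phi> \<kappa> (surface_pt w \<phi> (Disc x)
      (of_real r * (\<Sum>i | i < length w \<and> w ! i = x. tangent \<phi> i))) = c"
    \<comment> \<open>An eventual colour is unique because the filter \<open>at_right 0\<close> is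
      not trivial.\<close>
    with ev have "\<forall>\<^sub>F r in at_right (0::real). c = \<kappa> x"
      by eventually_elim simp
    then show "c = \<kappa> x" by simp
  qed
  with x show "induced_colouring w \<phi> (surface_colour w \<phi> \<kappa>) x = \<kappa> x"
    by (simp add: induced_colouring_def)
qed

lemma swap_surface_colour:
  assumes "compatible w \<phi> \<kappa>" "compatible w \<phi> (swap_colours (set w) \<kappa>)"
  shows "swap_colours (complement w \<phi>) (surface_colour w \<phi> \<kappa>) =
    surface_colour w \<phi> (swap_colours (set w) \<kappa>)"
proof (rule PiE_ext)
  show "swap_colours (complement w \<phi>) (surface_colour w \<phi> \<kappa>) \<in> complement w \<phi> \<rightarrow>\<^sub>E UNIV"
    by (simp add: swap_colours_def)
  show "surface_colour w \<phi> (swap_colours (set w) \<kappa>) \<in> complement w \<phi> \<rightarrow>\<^sub>E UNIV"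
    by (simp add: surface_colour_def)
  fix P assume P: "P \<in> complement w \<phi>"
  then obtain p t where p: "(p, t) \<in> topspace (collared_ribbon w \<phi>)" "off_loop p" "P = collapse w \<phi> (p, t)"
    unfolding complement_iff by blast
  have "p \<in> topspace (ribbon w \<phi>)" using p(1) by (simp add: topspace_collared_ribbon)
  then have "ribbon_colour w \<phi> (swap_colours (set w) \<kappa>) p = opp_colour (ribbon_colour w \<phi> \<kappa> p)"
    by (cases rule: ribbon_cases)
      (simp_all add: ribbon_colour_def disc_colour_def band_colour_def left_colour_def swap_colours_def)
  with P show "swap_colours (complement w \<phi>) (surface_colour w \<phi> \<kappa>) P =
      surface_colour w \<phi> (swap_colours (set w) \<kappa>) P"
    by (simp add: swap_colours_def[of "complement w \<phi>"] p(3) surface_colour_collapse[OF assms(1) p(1,2)]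
        surface_colour_collapse[OF assms(2) p(1,2)])
qed

text \<open>All bicolourings are known, and each induces the colouring it was built from; so
  construction (a) is a fibre of \<open>compatible\<close>.\<close>

lemma framing_to_colourings_eq:
  "framing_to_colourings w \<phi> = {\<kappa> \<in> colourings w. compatible w \<phi> \<kappa>}"
  unfolding framing_to_colourings_def region_bicolourings_eq image_image
  using induced_surface_colour by (auto simp: image_iff)

text \<open>Serves to show that the two bicolourings of a nonempty diagram are different.\<close>

lemma complement_nonempty:
  assumes "w \<noteq> []"
  shows "complement w \<phi> \<noteq> {}"
proof -
  have "surface_pt w \<phi> (Disc (hd w)) (Complex (1/2) (1/2)) \<in> complement w \<phi>"
    using assms cmod_le[of "Complex (1/2) (1/2)"]
    by (intro surface_pt_complement) (simp_all add: off_loop_def quad_def)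
  then show ?thesis by blast
qed

end

section \<open>The correspondence of classes\<close>

text \<open>The common form of \<open>framing_classes\<close> and
  \<open>colouring_classes\<close>.\<close>

definition involution_classes :: "'b set \<Rightarrow> ('b \<Rightarrow> 'b) \<Rightarrow> 'b set set" where
  "involution_classes A \<sigma> = A // {(a, b). a \<in> A \<and> b \<in> A \<and> (b = a \<or> b = \<sigma> a)}"

lemma involution_classes_eq:
  assumes "\<sigma> ` A \<subseteq> A"
  shows "involution_classes A \<sigma> = (\<lambda>a. {a, \<sigma> a}) ` A"
proof -
  have "{(a, b). a \<in> A \<and> b \<in> A \<and> (b = a \<or> b = \<sigma> a)} `` {a} = {a, \<sigma> a}" if "a \<in> A" for a
    using that assms by auto
  then show ?thesis
    by (auto simp: involution_classes_def quotient_def)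
qed

text \<open>\<open>F\<close> and \<open>G\<close> are the fibres of one relation, and every fibre is
  an orbit on the other side. Hence \<open>F\<close> takes the same value on both members of an
  orbit, and passing there and back returns the orbit.\<close>

lemma involution_classes_correspondence:
  assumes "\<sigma> ` A \<subseteq> A" "\<tau> ` B \<subseteq> B"
    and "\<And>a. a \<in> A \<Longrightarrow> \<exists>b\<in>B. F a = {b, \<tau> b}"
    and "\<And>b. b \<in> B \<Longrightarrow> \<exists>a\<in>A. G b = {a, \<sigma> a}"
    and "\<And>a b. a \<in> A \<Longrightarrow> b \<in> B \<Longrightarrow> b \<in> F a \<longleftrightarrow> a \<in> G b"
    and invol: "\<And>a. a \<in> A \<Longrightarrow> \<sigma> (\<sigma> a) = a"
  shows "\<Phi> \<in> involution_classes A \<sigma> \<Longrightarrow> (\<Union>a\<in>\<Phi>. F a) \<in> involution_classes B \<tau>"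
    and "\<Phi> \<in> involution_classes A \<sigma> \<Longrightarrow> (\<Union>b\<in>(\<Union>a\<in>\<Phi>. F a). G b) = \<Phi>"
proof -
  assume "\<Phi> \<in> involution_classes A \<sigma>"
  then obtain a where a: "a \<in> A" "\<Phi> = {a, \<sigma> a}"
    using involution_classes_eq[OF assms(1)] by auto
  have \<sigma>a: "\<sigma> a \<in> A" using a assms(1) by auto
  \<comment> \<open>The fibre of \<open>b\<close> is an orbit containing \<open>a\<close>, so it is
    the orbit of \<open>a\<close>.\<close>
  have fib: "G b = {a, \<sigma> a}" if "b \<in> B" "b \<in> F a" for b
  proof -
    obtain a0 where a0: "a0 \<in> A" "G b = {a0, \<sigma> a0}" using assms(4) \<open>b \<in> B\<close> by blast
    have "a \<in> G b" using assms(5) a that by blast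
    then have "a = a0 \<or> a = \<sigma> a0" using a0 by blast
    then show ?thesis using a0 invol by auto
  qed
  have FB: "F c \<subseteq> B" if "c \<in> A" for c using assms(2,3) that by fastforce
  have sub: "F a \<subseteq> F (\<sigma> a)"
    using fib FB a \<sigma>a assms(5) by blast
  have "F (\<sigma> a) \<subseteq> F a"
  proof
    fix b assume b: "b \<in> F (\<sigma> a)"
    then have "b \<in> B" using FB \<sigma>a by blast
    then obtain a0 where a0: "a0 \<in> A" "G b = {a0, \<sigma> a0}" using assms(4) by blast
    have "\<sigma> a \<in> G b" using assms(5) \<sigma>a \<open>b \<in> B\<close> b by blast
    then have "\<sigma> a = a0 \<or> \<sigma> a = \<sigma> a0" using a0 by blast
    then have "a \<in> G b" using a0 invol a by (metis insert_iff)
    then show "b \<in> F a" using assms(5) a \<open>b \<in> B\<close> by blast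
  qed
  \<comment> \<open>The union over a class is thus a single fibre.\<close>
  with sub have un: "(\<Union>a\<in>\<Phi>. F a) = F a" using a by auto
  obtain b where b: "b \<in> B" "F a = {b, \<tau> b}" using assms(3) a by blast
  show "(\<Union>a\<in>\<Phi>. F a) \<in> involution_classes B \<tau>"
    unfolding un involution_classes_eq[OF assms(2)] using b by blast
  show "(\<Union>b\<in>(\<Union>a\<in>\<Phi>. F a). G b) = \<Phi>"
    unfolding un using fib FB a b by auto
qed

theorem proposition2p15:
  fixes w :: "'a list"
  assumes "chord_diagram w"
    and "\<forall>x\<in>set w. even (interlace_degree w x)"
  shows
    "(\<forall>\<phi>\<in>framings w.
        (\<exists>b. region_bicolourings w \<phi> = {b, swap_colours (complement w \<phi>) b} \<and>
             (w \<noteq> [] \<longrightarrow> b \<noteq> swap_colours (complement w \<phi>) b)) \<and>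
        (\<forall>b\<in>region_bicolourings w \<phi>.
             induced_colouring w \<phi> b \<in> colourings w \<and>
             (\<forall>x\<in>set w. \<forall>\<^sub>F r in at_right 0.
                b (surface_pt w \<phi> (Disc x)
                     (of_real r * (\<Sum>i | i < length w \<and> w ! i = x. tangent \<phi> i)))
                = induced_colouring w \<phi> b x) \<and>
             induced_colouring w \<phi> (swap_colours (complement w \<phi>) b)
               = swap_colours (set w) (induced_colouring w \<phi> b)) \<and>
        (\<exists>\<kappa>\<in>colourings w. framing_to_colourings w \<phi> = {\<kappa>, swap_colours (set w) \<kappa>}))
   \<and> (\<forall>\<kappa>\<in>colourings w.
        (\<forall>i<length w. \<forall>v. \<exists>!\<phi>. \<phi> \<in> colouring_to_framings w \<kappa> \<and> \<phi> i = v) \<and>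
        colouring_to_framings w \<kappa> \<subseteq> framings w \<and>
        (\<exists>\<phi>. colouring_to_framings w \<kappa> = {\<phi>, invert_frames w \<phi>}))
   \<and> (\<forall>\<phi>\<in>framings w. \<forall>\<kappa>\<in>colourings w.
        \<kappa> \<in> framing_to_colourings w \<phi> \<longleftrightarrow> \<phi> \<in> colouring_to_framings w \<kappa>)
   \<and> bij_betw (\<lambda>\<Phi>. \<Union>\<phi>\<in>\<Phi>. framing_to_colourings w \<phi>) (framing_classes w) (colouring_classes w)
   \<and> bij_betw (\<lambda>X. \<Union>\<kappa>\<in>X. colouring_to_framings w \<kappa>) (colouring_classes w) (framing_classes w)
   \<and> (\<forall>\<Phi>\<in>framing_classes w.
        (\<Union>\<kappa>\<in>(\<Union>\<phi>\<in>\<Phi>. framing_to_colourings w \<phi>). colouring_to_framings w \<kappa>) = \<Phi>)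
   \<and> (\<forall>X\<in>colouring_classes w.
        (\<Union>\<phi>\<in>(\<Union>\<kappa>\<in>X. colouring_to_framings w \<kappa>). framing_to_colourings w \<phi>) = X)"
proof (intro conjI)
  let ?comp = "\<lambda>\<phi>. {\<kappa> \<in> colourings w. compatible w \<phi> \<kappa>}"
  have loc: "framed_chord_diagram w \<phi>" if "\<phi> \<in> framings w" for \<phi>
    using assms(1) that by (simp add: framed_chord_diagram_def)
  note F_eq = framed_chord_diagram.framing_to_colourings_eq[OF loc]
  have F: "\<exists>\<kappa>\<in>colourings w. framing_to_colourings w \<phi> = {\<kappa>, swap_colours (set w) \<kappa>}"
    if "\<phi> \<in> framings w" for \<phi>
    unfolding F_eq[OF that] by (rule compatible_colourings[OF assms that])
  have G_framings: "colouring_to_framings w \<kappa> \<subseteq> framings w" for \<kappa>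
    using compatible_framing[OF assms] by blast
  have G: "\<exists>\<phi>\<in>framings w. colouring_to_framings w \<kappa> = {\<phi>, invert_frames w \<phi>}" for \<kappa>
  proof
    show "colouring_to_framings w \<kappa> =
        {alternating_framing w \<kappa> True, invert_frames w (alternating_framing w \<kappa> True)}"
      by (simp add: colouring_to_framings_alternating[OF assms(1)] invert_alternating_framing)
    then show "alternating_framing w \<kappa> True \<in> framings w"
      using G_framings by blast
  qed
  \<comment> \<open>Framings and colourings are extensional, so both memberships reduce to
    \<open>compatible\<close>.\<close>
  have FG: "\<kappa> \<in> framing_to_colourings w \<phi> \<longleftrightarrow> \<phi> \<in> colouring_to_framings w \<kappa>"
    if "\<phi> \<in> framings w" "\<kappa> \<in> colourings w" for \<phi> \<kappa>
    using that unfolding F_eq[OF that(1)] colouring_to_framings_eq by (auto simp: framings_def)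

  show "\<forall>\<phi>\<in>framings w.
        (\<exists>b. region_bicolourings w \<phi> = {b, swap_colours (complement w \<phi>) b} \<and>
             (w \<noteq> [] \<longrightarrow> b \<noteq> swap_colours (complement w \<phi>) b)) \<and>
        (\<forall>b\<in>region_bicolourings w \<phi>.
             induced_colouring w \<phi> b \<in> colourings w \<and>
             (\<forall>x\<in>set w. \<forall>\<^sub>F r in at_right 0.
                b (surface_pt w \<phi> (Disc x)
                     (of_real r * (\<Sum>i | i < length w \<and> w ! i = x. tangent \<phi> i)))
                = induced_colouring w \<phi> b x) \<and>
             induced_colouring w \<phi> (swap_colours (complement w \<phi>) b)
               = swap_colours (set w) (induced_colouring w \<phi> b)) \<and>
        (\<exists>\<kappa>\<in>colourings w. framing_to_colourings w \<phi> = {\<kappa>, swap_colours (set w) \<kappa>})"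
  proof (intro ballI conjI)
    fix \<phi> assume \<phi>: "\<phi> \<in> framings w"
    interpret framed_chord_diagram w \<phi> by (rule loc[OF \<phi>])
    show "\<exists>\<kappa>\<in>colourings w. framing_to_colourings w \<phi> = {\<kappa>, swap_colours (set w) \<kappa>}"
      by (rule F[OF \<phi>])
    obtain \<kappa> where \<kappa>: "?comp \<phi> = {\<kappa>, swap_colours (set w) \<kappa>}"
      using compatible_colourings[OF assms \<phi>] by blast
    then have comp: "compatible w \<phi> \<kappa>" "compatible w \<phi> (swap_colours (set w) \<kappa>)"
      by blast+
    show "\<exists>b. region_bicolourings w \<phi> = {b, swap_colours (complement w \<phi>) b} \<and>
             (w \<noteq> [] \<longrightarrow> b \<noteq> swap_colours (complement w \<phi>) b)"
    proof (intro exI conjI impI)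
      show "region_bicolourings w \<phi> = {surface_colour w \<phi> \<kappa>,
          swap_colours (complement w \<phi>) (surface_colour w \<phi> \<kappa>)}"
        by (simp add: region_bicolourings_eq \<kappa> swap_surface_colour[OF comp])
      assume "w \<noteq> []"
      then obtain P where "P \<in> complement w \<phi>"
        using complement_nonempty by blast
      then have "swap_colours (complement w \<phi>) (surface_colour w \<phi> \<kappa>) P \<noteq> surface_colour w \<phi> \<kappa> P"
        by (simp add: swap_colours_def)
      then show "surface_colour w \<phi> \<kappa> \<noteq> swap_colours (complement w \<phi>) (surface_colour w \<phi> \<kappa>)"
        by metis
    qed
    fix b assume "b \<in> region_bicolourings w \<phi>"
    then obtain \<eta> where \<eta>: "\<eta> \<in> colourings w" "compatible w \<phi> \<eta>" "b = surface_colour w \<phi> \<eta>"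
      unfolding region_bicolourings_eq by blast
    have ind: "induced_colouring w \<phi> b = \<eta>"
      unfolding \<eta>(3) by (rule induced_surface_colour[OF \<eta>(2,1)])
    show "induced_colouring w \<phi> b \<in> colourings w"
      by (simp add: ind \<eta>(1))
    show "\<forall>\<^sub>F r in at_right 0. b (surface_pt w \<phi> (Disc x)
        (of_real r * (\<Sum>i | i < length w \<and> w ! i = x. tangent \<phi> i))) = induced_colouring w \<phi> b x"
      if "x \<in> set w" for x
      unfolding ind unfolding \<eta>(3) by (rule surface_colour_sum_direction[OF \<eta>(2) that])
    have swap: "compatible w \<phi> (swap_colours (set w) \<eta>)"
      using \<eta>(2) by (simp add: compatible_swap_colours)
    show "induced_colouring w \<phi> (swap_colours (complement w \<phi>) b) =
        swap_colours (set w) (induced_colouring w \<phi> b)"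
      unfolding ind unfolding \<eta>(3) swap_surface_colour[OF \<eta>(2) swap]
      by (rule induced_surface_colour[OF swap swap_colours_colourings])
  qed
  show "\<forall>\<kappa>\<in>colourings w.
        (\<forall>i<length w. \<forall>v. \<exists>!\<phi>. \<phi> \<in> colouring_to_framings w \<kappa> \<and> \<phi> i = v) \<and>
        colouring_to_framings w \<kappa> \<subseteq> framings w \<and>
        (\<exists>\<phi>. colouring_to_framings w \<kappa> = {\<phi>, invert_frames w \<phi>})"
    using ex1_colouring_to_framings[OF assms(1)] G_framings G by blast
  show "\<forall>\<phi>\<in>framings w. \<forall>\<kappa>\<in>colourings w.
        \<kappa> \<in> framing_to_colourings w \<phi> \<longleftrightarrow> \<phi> \<in> colouring_to_framings w \<kappa>"
    using FG by blast

  have invA: "invert_frames w ` framings w \<subseteq> framings w"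
    using invert_frames_framings by blast
  have invB: "swap_colours (set w) ` colourings w \<subseteq> colourings w"
    using swap_colours_colourings by blast
  have AA: "invert_frames w (invert_frames w \<phi>) = \<phi>" if "\<phi> \<in> framings w" for \<phi>
    by (rule invert_invert_frames[OF that])
  have BB: "swap_colours (set w) (swap_colours (set w) \<kappa>) = \<kappa>" if "\<kappa> \<in> colourings w" for \<kappa>
    by (rule swap_swap_colours[OF that])
  have classes: "framing_classes w = involution_classes (framings w) (invert_frames w)"
    "colouring_classes w = involution_classes (colourings w) (swap_colours (set w))"
    by (simp_all add: framing_classes_def colouring_classes_def involution_classes_def)
  \<comment> \<open>The abstract correspondence is used twice, with the roles of framings and
    colourings exchanged.\<close>
  note fwd = involution_classes_correspondence[OF invA invB F G FG AA, folded classes]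
  note bwd = involution_classes_correspondence[OF invB invA G F FG[symmetric] BB, folded classes]
  show "\<forall>\<Phi>\<in>framing_classes w.
        (\<Union>\<kappa>\<in>(\<Union>\<phi>\<in>\<Phi>. framing_to_colourings w \<phi>). colouring_to_framings w \<kappa>) = \<Phi>"
    using fwd(2) by blast
  show "\<forall>X\<in>colouring_classes w.
        (\<Union>\<phi>\<in>(\<Union>\<kappa>\<in>X. colouring_to_framings w \<kappa>). framing_to_colourings w \<phi>) = X"
    using bwd(2) by blast
  let ?f = "\<lambda>\<Phi>. \<Union>\<phi>\<in>\<Phi>. framing_to_colourings w \<phi>"
  let ?g = "\<lambda>X. \<Union>\<kappa>\<in>X. colouring_to_framings w \<kappa>"
  have "\<forall>\<Phi>\<in>framing_classes w. ?g (?f \<Phi>) = \<Phi>" "\<forall>X\<in>colouring_classes w. ?f (?g X) = X"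
    "?f ` framing_classes w \<subseteq> colouring_classes w" "?g ` colouring_classes w \<subseteq> framing_classes w"
    by (intro ballI fwd(2) bwd(2) image_subsetI fwd(1) bwd(1); assumption)+
  then show "bij_betw ?f (framing_classes w) (colouring_classes w)"
    "bij_betw ?g (colouring_classes w) (framing_classes w)"
    by (simp_all only: bij_betw_byWitness)
qed

end
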